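(* If a symmetric monoidal category $(\mathcal C,\otimes,I)$ admits the symmetric algebra construction, then $\mathcal C$ admits algebraically-free commutative monoids.
   Context: Let $\mathbb B$ be the category whose objects are natural numbers, with $\mathbb B(n,m)=\varnothing$ for $n\ne m$ and $\mathbb B(n,n)=\mathfrak S_n$. For $X\in\mathcal C$ there is a functor $X^{\otimes(-)}\colon\mathbb B\to\mathcal C$ sending $n$ to $X^{\otimes n}$ and $\sigma\in\mathfrak S_n$ to the map $X^{\otimes n}\to X^{\otimes n}$ permuting the tensor factors according to $\sigma$. $\mathcal C$ admits the symmetric algebra construction if each functor $X^{\otimes(-)}\colon\mathbb B\to\mathcal C$ has a colimit which is preserved by the tensor product in each variable. For $X\in\mathcal C$, a commuting $X$-action is a pair $(A,\alpha\colon A\otimes X\to A)$ with $\alpha\circ(\alpha\otimes X)\circ(A\otimes\sigma_{X,X})=\alpha\circ(\alpha\otimes X)$ ($\sigma$ the symmetry); a map $(A,\alpha)\to(B,\beta)$ is $f\colon A\to B$ with $f\circ\alpha=\beta\circ(f\otimes X)$; these form the category $\mathsf{CAct}[X]$. $\mathcal C$ admits (is endowed with) algebraically-free commutative monoids if for each $X\in\mathcal C$ there is a commutative monoid $(SX,\mathsf u_X\colon I\to SX,\nabla_X\colon SX\otimes SX\to SX)$ and a map $\eta_X\colon X\to SX$ exhibiting it as the free commutative monoid on $X$, such that the functor $\eta_X^*\colon\mathsf{Mod}[SX]\to\mathsf{CAct}[X]$, sending a right $SX$-module $(A,\rho)$ to $(A,\rho\circ(A\otimes\eta_X))$, is an isomorphism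 of categories. *)

theory Defs
  imports "HOL-Combinatorics.Permutations"
begin

section \<open>Categories, functors, colimits\<close>

record ('o, 'a) category =
  Ob :: "'o set"
  Arr :: "'a set"
  Dom :: "'a \<Rightarrow> 'o"
  Cod :: "'a \<Rightarrow> 'o"
  Id :: "'o \<Rightarrow> 'a"
  Comp :: "'a \<Rightarrow> 'a \<Rightarrow> 'a"  (infixr "\<cdot>\<index>" 70)

definition hom :: "('o, 'a, 'z) category_scheme \<Rightarrow> 'o \<Rightarrow> 'o \<Rightarrow> 'a set" where
  "hom C A B = {f \<in> Arr C. Dom C f = A \<and> Cod C f = B}"

locale category =
  fixes C :: "('o, 'a, 'z) category_scheme" (structure)
  assumes dom_in_Ob: "f \<in> Arr C \<Longrightarrow> Dom C f \<in> Ob C"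
    and cod_in_Ob: "f \<in> Arr C \<Longrightarrow> Cod C f \<in> Ob C"
    and Id_hom: "A \<in> Ob C \<Longrightarrow> Id C A \<in> hom C A A"
    and Comp_hom: "\<lbrakk>f \<in> hom C A B; g \<in> hom C B D\<rbrakk> \<Longrightarrow> g \<cdot> f \<in> hom C A D"
    and Comp_Id: "f \<in> hom C A B \<Longrightarrow> f \<cdot> Id C A = f"
    and Id_Comp: "f \<in> hom C A B \<Longrightarrow> Id C B \<cdot> f = f"
    and Comp_assoc: "\<lbrakk>f \<in> hom C A B; g \<in> hom C B D; h \<in> hom C D E\<rbrakk>
      \<Longrightarrow> (h \<cdot> g) \<cdot> f = h \<cdot> (g \<cdot> f)"

definition inverse_arrows :: "('o, 'a, 'z) category_scheme \<Rightarrow> 'a \<Rightarrow> 'a \<Rightarrow> bool" where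
  "inverse_arrows C f g \<longleftrightarrow> f \<in> Arr C \<and> g \<in> hom C (Cod C f) (Dom C f) \<and>
     g \<cdot>\<^bsub>C\<^esub> f = Id C (Dom C f) \<and> f \<cdot>\<^bsub>C\<^esub> g = Id C (Cod C f)"

definition is_iso :: "('o, 'a, 'z) category_scheme \<Rightarrow> 'a \<Rightarrow> bool" where
  "is_iso C f \<longleftrightarrow> (\<exists>g. inverse_arrows C f g)"

definition inv_arrow :: "('o, 'a, 'z) category_scheme \<Rightarrow> 'a \<Rightarrow> 'a" where
  "inv_arrow C f = (THE g. inverse_arrows C f g)"

record ('o, 'a, 'p, 'b) functor_data =
  ob_map :: "'o \<Rightarrow> 'p"
  arr_map :: "'a \<Rightarrow> 'b"

locale is_functor = src: category C + tgt: category D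
  for C :: "('o, 'a, 'y) category_scheme" and D :: "('p, 'b, 'z) category_scheme" +
  fixes F :: "('o, 'a, 'p, 'b) functor_data"
  assumes ob_map_Ob: "A \<in> Ob C \<Longrightarrow> ob_map F A \<in> Ob D"
    and arr_map_hom: "f \<in> hom C A B \<Longrightarrow> arr_map F f \<in> hom D (ob_map F A) (ob_map F B)"
    and arr_map_Id: "A \<in> Ob C \<Longrightarrow> arr_map F (Id C A) = Id D (ob_map F A)"
    and arr_map_Comp: "\<lbrakk>f \<in> hom C A B; g \<in> hom C B E\<rbrakk>
      \<Longrightarrow> arr_map F (g \<cdot>\<^bsub>C\<^esub> f) = arr_map F g \<cdot>\<^bsub>D\<^esub> arr_map F f"

definition functor_comp ::
  "('p, 'b, 'q, 'c) functor_data \<Rightarrow> ('o, 'a, 'p, 'b) functor_data \<Rightarrow> ('o, 'a, 'q, 'c) functor_data" where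
  "functor_comp G F = \<lparr>ob_map = ob_map G \<circ> ob_map F, arr_map = arr_map G \<circ> arr_map F\<rparr>"

definition category_isomorphism ::
  "('o, 'a, 'y) category_scheme \<Rightarrow> ('p, 'b, 'z) category_scheme
    \<Rightarrow> ('o, 'a, 'p, 'b) functor_data \<Rightarrow> bool" where
  "category_isomorphism C D F \<longleftrightarrow> is_functor C D F \<and>
    (\<exists>G. is_functor D C G \<and>
      (\<forall>A \<in> Ob C. ob_map G (ob_map F A) = A) \<and> (\<forall>f \<in> Arr C. arr_map G (arr_map F f) = f) \<and>
      (\<forall>B \<in> Ob D. ob_map F (ob_map G B) = B) \<and> (\<forall>g \<in> Arr D. arr_map F (arr_map G g) = g))"

definition is_cocone ::
  "('j, 'k, 'y) category_scheme \<Rightarrow> ('o, 'a, 'z) category_scheme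
    \<Rightarrow> ('j, 'k, 'o, 'a) functor_data \<Rightarrow> 'o \<Rightarrow> ('j \<Rightarrow> 'a) \<Rightarrow> bool" where
  "is_cocone J C F Z \<kappa> \<longleftrightarrow> Z \<in> Ob C \<and>
    (\<forall>j \<in> Ob J. \<kappa> j \<in> hom C (ob_map F j) Z) \<and>
    (\<forall>k \<in> Arr J. \<kappa> (Cod J k) \<cdot>\<^bsub>C\<^esub> arr_map F k = \<kappa> (Dom J k))"

definition is_colimit ::
  "('j, 'k, 'y) category_scheme \<Rightarrow> ('o, 'a, 'z) category_scheme
    \<Rightarrow> ('j, 'k, 'o, 'a) functor_data \<Rightarrow> 'o \<Rightarrow> ('j \<Rightarrow> 'a) \<Rightarrow> bool" where
  "is_colimit J C F L \<iota> \<longleftrightarrow> is_cocone J C F L \<iota> \<and>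
    (\<forall>Z \<kappa>. is_cocone J C F Z \<kappa> \<longrightarrow>
      (\<exists>!h. h \<in> hom C L Z \<and> (\<forall>j \<in> Ob J. h \<cdot>\<^bsub>C\<^esub> \<iota> j = \<kappa> j)))"

definition preserves_colimit ::
  "('j, 'k, 'x) category_scheme \<Rightarrow> ('p, 'b, 'z) category_scheme
    \<Rightarrow> ('o, 'a, 'p, 'b) functor_data \<Rightarrow> ('j, 'k, 'o, 'a) functor_data \<Rightarrow> 'o \<Rightarrow> ('j \<Rightarrow> 'a) \<Rightarrow> bool" where
  "preserves_colimit J D G F L \<iota> \<longleftrightarrow>
    is_colimit J D (functor_comp G F) (ob_map G L) (\<lambda>j. arr_map G (\<iota> j))"


section \<open>Symmetric monoidal categories\<close>

text \<open>The tensor product is written \<open>\<odot>\<close> on objects and \<open>\<otimes>\<close> on arrows.\<close>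

record ('o, 'a) sym_mon_data = "('o, 'a) category" +
  tensor_ob :: "'o \<Rightarrow> 'o \<Rightarrow> 'o"  (infixr "\<odot>\<index>" 75)
  tensor_arr :: "'a \<Rightarrow> 'a \<Rightarrow> 'a"  (infixr "\<otimes>\<index>" 75)
  unit_ob :: "'o"  ("\<one>\<index>")
  associator :: "'o \<Rightarrow> 'o \<Rightarrow> 'o \<Rightarrow> 'a"
  left_unitor :: "'o \<Rightarrow> 'a"
  right_unitor :: "'o \<Rightarrow> 'a"
  symmetry :: "'o \<Rightarrow> 'o \<Rightarrow> 'a"

locale symmetric_monoidal_category = category C
  for C :: "('o, 'a, 'z) sym_mon_data_scheme" (structure) +
  assumes unit_Ob: "\<one> \<in> Ob C"
    and tensor_Ob: "\<lbrakk>A \<in> Ob C; B \<in> Ob C\<rbrakk> \<Longrightarrow> A \<odot> B \<in> Ob C"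
    and tensor_hom: "\<lbrakk>f \<in> hom C A A'; g \<in> hom C B B'\<rbrakk> \<Longrightarrow> f \<otimes> g \<in> hom C (A \<odot> B) (A' \<odot> B')"
    and tensor_Id: "\<lbrakk>A \<in> Ob C; B \<in> Ob C\<rbrakk> \<Longrightarrow> Id C A \<otimes> Id C B = Id C (A \<odot> B)"
    and tensor_Comp: "\<lbrakk>f \<in> hom C A A'; f' \<in> hom C A' A''; g \<in> hom C B B'; g' \<in> hom C B' B''\<rbrakk>
      \<Longrightarrow> (f' \<cdot> f) \<otimes> (g' \<cdot> g) = (f' \<otimes> g') \<cdot> (f \<otimes> g)"
    and associator_hom: "\<lbrakk>A \<in> Ob C; B \<in> Ob C; D \<in> Ob C\<rbrakk>
      \<Longrightarrow> associator C A B D \<in> hom C ((A \<odot> B) \<odot> D) (A \<odot> (B \<odot> D))"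
    and associator_iso: "\<lbrakk>A \<in> Ob C; B \<in> Ob C; D \<in> Ob C\<rbrakk> \<Longrightarrow> is_iso C (associator C A B D)"
    and associator_natural: "\<lbrakk>f \<in> hom C A A'; g \<in> hom C B B'; h \<in> hom C D D'\<rbrakk>
      \<Longrightarrow> associator C A' B' D' \<cdot> ((f \<otimes> g) \<otimes> h) = (f \<otimes> (g \<otimes> h)) \<cdot> associator C A B D"
    and left_unitor_hom: "A \<in> Ob C \<Longrightarrow> left_unitor C A \<in> hom C (\<one> \<odot> A) A"
    and left_unitor_iso: "A \<in> Ob C \<Longrightarrow> is_iso C (left_unitor C A)"
    and left_unitor_natural: "f \<in> hom C A A'
      \<Longrightarrow> left_unitor C A' \<cdot> (Id C \<one> \<otimes> f) = f \<cdot> left_unitor C A"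
    and right_unitor_hom: "A \<in> Ob C \<Longrightarrow> right_unitor C A \<in> hom C (A \<odot> \<one>) A"
    and right_unitor_iso: "A \<in> Ob C \<Longrightarrow> is_iso C (right_unitor C A)"
    and right_unitor_natural: "f \<in> hom C A A'
      \<Longrightarrow> right_unitor C A' \<cdot> (f \<otimes> Id C \<one>) = f \<cdot> right_unitor C A"
    and pentagon: "\<lbrakk>A \<in> Ob C; B \<in> Ob C; D \<in> Ob C; E \<in> Ob C\<rbrakk>
      \<Longrightarrow> (Id C A \<otimes> associator C B D E) \<cdot> associator C A (B \<odot> D) E \<cdot> (associator C A B D \<otimes> Id C E)
        = associator C A B (D \<odot> E) \<cdot> associator C (A \<odot> B) D E"
    and triangle: "\<lbrakk>A \<in> Ob C; B \<in> Ob C\<rbrakk>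
      \<Longrightarrow> (Id C A \<otimes> left_unitor C B) \<cdot> associator C A \<one> B = right_unitor C A \<otimes> Id C B"
    and symmetry_hom: "\<lbrakk>A \<in> Ob C; B \<in> Ob C\<rbrakk> \<Longrightarrow> symmetry C A B \<in> hom C (A \<odot> B) (B \<odot> A)"
    and symmetry_natural: "\<lbrakk>f \<in> hom C A A'; g \<in> hom C B B'\<rbrakk>
      \<Longrightarrow> symmetry C A' B' \<cdot> (f \<otimes> g) = (g \<otimes> f) \<cdot> symmetry C A B"
    and symmetry_involutive: "\<lbrakk>A \<in> Ob C; B \<in> Ob C\<rbrakk>
      \<Longrightarrow> symmetry C B A \<cdot> symmetry C A B = Id C (A \<odot> B)"
    and hexagon: "\<lbrakk>A \<in> Ob C; B \<in> Ob C; D \<in> Ob C\<rbrakk>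
      \<Longrightarrow> associator C B D A \<cdot> symmetry C A (B \<odot> D) \<cdot> associator C A B D
        = (Id C B \<otimes> symmetry C A D) \<cdot> associator C B A D \<cdot> (symmetry C A B \<otimes> Id C D)"

definition tensor_left :: "('o, 'a, 'z) sym_mon_data_scheme \<Rightarrow> 'o \<Rightarrow> ('o, 'a, 'o, 'a) functor_data" where
  "tensor_left C A = \<lparr>ob_map = (\<lambda>B. A \<odot>\<^bsub>C\<^esub> B), arr_map = (\<lambda>f. Id C A \<otimes>\<^bsub>C\<^esub> f)\<rparr>"

definition tensor_right :: "('o, 'a, 'z) sym_mon_data_scheme \<Rightarrow> 'o \<Rightarrow> ('o, 'a, 'o, 'a) functor_data" where
  "tensor_right C A = \<lparr>ob_map = (\<lambda>B. B \<odot>\<^bsub>C\<^esub> A), arr_map = (\<lambda>f. f \<otimes>\<^bsub>C\<^esub> Id C A)\<rparr>"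


section \<open>The symmetric algebra construction\<close>

definition perm_category :: "(nat, nat \<times> (nat \<Rightarrow> nat)) category" where
  "perm_category = \<lparr>
     Ob = UNIV,
     Arr = {(n, \<sigma>). \<sigma> permutes {..<n}},
     Dom = fst,
     Cod = fst,
     Id = (\<lambda>n. (n, id)),
     Comp = (\<lambda>(n, \<sigma>) (_, \<tau>). (n, \<sigma> \<circ> \<tau>))\<rparr>"

primrec tensor_power :: "('o, 'a, 'z) sym_mon_data_scheme \<Rightarrow> 'o \<Rightarrow> nat \<Rightarrow> 'o" where
  "tensor_power C X 0 = \<one>\<^bsub>C\<^esub>"
| "tensor_power C X (Suc n) = tensor_power C X n \<odot>\<^bsub>C\<^esub> X"

text \<open>The tensor factors of the \<open>n\<close>-th power of \<open>X\<close> sit at the positions \<open>0, \<dots>, n - 1\<close>, from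
  left to right. For \<open>i + 1 < n\<close>, the arrow \<open>swap_factors C X i n\<close> exchanges the factors at
  the positions \<open>i\<close> and \<open>i + 1\<close>; other values of \<open>i\<close> are not used.\<close>

primrec swap_factors :: "('o, 'a, 'z) sym_mon_data_scheme \<Rightarrow> 'o \<Rightarrow> nat \<Rightarrow> nat \<Rightarrow> 'a" where
  "swap_factors C X i 0 = Id C \<one>\<^bsub>C\<^esub>"
| "swap_factors C X i (Suc n) =
    (if Suc i = n
     then inv_arrow C (associator C (tensor_power C X i) X X) \<cdot>\<^bsub>C\<^esub>
          (Id C (tensor_power C X i) \<otimes>\<^bsub>C\<^esub> symmetry C X X) \<cdot>\<^bsub>C\<^esub>
          associator C (tensor_power C X i) X X
     else swap_factors C X i n \<otimes>\<^bsub>C\<^esub> Id C X)"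

text \<open>The arrow \<open>permute_factors C X n \<sigma>\<close> moves the factor at position \<open>i\<close> to position \<open>\<sigma> i\<close>.
  A permutation \<open>\<sigma>\<close> of \<open>{..<Suc n}\<close> is first a permutation \<open>\<sigma>'\<close> of \<open>{..<n}\<close>, namely
  \<open>\<sigma>\<close> with the value \<open>\<sigma> n\<close> squeezed out, followed by the cycle which carries \<open>n\<close> down to \<open>\<sigma> n\<close>;
  the latter is the composite of the exchanges of \<open>i\<close> and \<open>i + 1\<close> for
  \<open>i = n - 1, \<dots>, \<sigma> n\<close>, in this order.\<close>

primrec permute_factors ::
  "('o, 'a, 'z) sym_mon_data_scheme \<Rightarrow> 'o \<Rightarrow> nat \<Rightarrow> (nat \<Rightarrow> nat) \<Rightarrow> 'a" where
  "permute_factors C X 0 \<sigma> = Id C \<one>\<^bsub>C\<^esub>"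
| "permute_factors C X (Suc n) \<sigma> =
    foldr (\<lambda>i g. swap_factors C X i (Suc n) \<cdot>\<^bsub>C\<^esub> g) [\<sigma> n..<n] (Id C (tensor_power C X (Suc n))) \<cdot>\<^bsub>C\<^esub>
    (permute_factors C X n (\<lambda>i. if i < n then (if \<sigma> n < \<sigma> i then \<sigma> i - 1 else \<sigma> i) else i)
       \<otimes>\<^bsub>C\<^esub> Id C X)"

definition power_functor ::
  "('o, 'a, 'z) sym_mon_data_scheme \<Rightarrow> 'o \<Rightarrow> (nat, nat \<times> (nat \<Rightarrow> nat), 'o, 'a) functor_data" where
  "power_functor C X =
    \<lparr>ob_map = tensor_power C X, arr_map = (\<lambda>(n, \<sigma>). permute_factors C X n \<sigma>)\<rparr>"

definition admits_symmetric_algebra_construction :: "('o, 'a, 'z) sym_mon_data_scheme \<Rightarrow> bool" where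
  "admits_symmetric_algebra_construction C \<longleftrightarrow>
    (\<forall>X \<in> Ob C. \<exists>L \<iota>.
      is_colimit perm_category C (power_functor C X) L \<iota> \<and>
      (\<forall>A \<in> Ob C.
        preserves_colimit perm_category C (tensor_left C A) (power_functor C X) L \<iota> \<and>
        preserves_colimit perm_category C (tensor_right C A) (power_functor C X) L \<iota>))"


section \<open>Algebraically-free commutative monoids\<close>

definition commutative_monoid_object ::
  "('o, 'a, 'z) sym_mon_data_scheme \<Rightarrow> 'o \<Rightarrow> 'a \<Rightarrow> 'a \<Rightarrow> bool" where
  "commutative_monoid_object C M u m \<longleftrightarrow>
    M \<in> Ob C \<and> u \<in> hom C \<one>\<^bsub>C\<^esub> M \<and> m \<in> hom C (M \<odot>\<^bsub>C\<^esub> M) M \<and>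
    m \<cdot>\<^bsub>C\<^esub> (m \<otimes>\<^bsub>C\<^esub> Id C M) = m \<cdot>\<^bsub>C\<^esub> (Id C M \<otimes>\<^bsub>C\<^esub> m) \<cdot>\<^bsub>C\<^esub> associator C M M M \<and>
    m \<cdot>\<^bsub>C\<^esub> (u \<otimes>\<^bsub>C\<^esub> Id C M) = left_unitor C M \<and>
    m \<cdot>\<^bsub>C\<^esub> (Id C M \<otimes>\<^bsub>C\<^esub> u) = right_unitor C M \<and>
    m \<cdot>\<^bsub>C\<^esub> symmetry C M M = m"

definition monoid_hom ::
  "('o, 'a, 'z) sym_mon_data_scheme \<Rightarrow> 'o \<Rightarrow> 'a \<Rightarrow> 'a \<Rightarrow> 'o \<Rightarrow> 'a \<Rightarrow> 'a \<Rightarrow> 'a set" where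
  "monoid_hom C M u m N v n =
    {f \<in> hom C M N. f \<cdot>\<^bsub>C\<^esub> u = v \<and> f \<cdot>\<^bsub>C\<^esub> m = n \<cdot>\<^bsub>C\<^esub> (f \<otimes>\<^bsub>C\<^esub> f)}"

definition free_commutative_monoid ::
  "('o, 'a, 'z) sym_mon_data_scheme \<Rightarrow> 'o \<Rightarrow> 'o \<Rightarrow> 'a \<Rightarrow> 'a \<Rightarrow> 'a \<Rightarrow> bool" where
  "free_commutative_monoid C X S u m \<eta> \<longleftrightarrow>
    commutative_monoid_object C S u m \<and> \<eta> \<in> hom C X S \<and>
    (\<forall>N v n g. commutative_monoid_object C N v n \<and> g \<in> hom C X N \<longrightarrow>
      (\<exists>!h. h \<in> monoid_hom C S u m N v n \<and> h \<cdot>\<^bsub>C\<^esub> \<eta> = g))"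

text \<open>For a set \<open>P\<close> of pairs \<open>(A, \<alpha>)\<close> with \<open>\<alpha>\<close> an arrow from \<open>A \<odot> X\<close> to \<open>A\<close>: the category with
  object set \<open>P\<close> and all maps of such actions. An arrow carries its source and target.\<close>

definition action_category ::
  "('o, 'a, 'z) sym_mon_data_scheme \<Rightarrow> 'o \<Rightarrow> ('o \<times> 'a) set
    \<Rightarrow> ('o \<times> 'a, ('o \<times> 'a) \<times> 'a \<times> ('o \<times> 'a)) category" where
  "action_category C X P = \<lparr>
     Ob = P,
     Arr = {((A, \<alpha>), f, (B, \<beta>)) | A \<alpha> f B \<beta>. (A, \<alpha>) \<in> P \<and> (B, \<beta>) \<in> P \<and> f \<in> hom C A B \<and>
              f \<cdot>\<^bsub>C\<^esub> \<alpha> = \<beta> \<cdot>\<^bsub>C\<^esub> (f \<otimes>\<^bsub>C\<^esub> Id C X)},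
     Dom = (\<lambda>(a, f, b). a),
     Cod = (\<lambda>(a, f, b). b),
     Id = (\<lambda>(A, \<alpha>). ((A, \<alpha>), Id C A, (A, \<alpha>))),
     Comp = (\<lambda>(_, g, c) (a, f, _). (a, g \<cdot>\<^bsub>C\<^esub> f, c))\<rparr>"

definition module_category ::
  "('o, 'a, 'z) sym_mon_data_scheme \<Rightarrow> 'o \<Rightarrow> 'a \<Rightarrow> 'a
    \<Rightarrow> ('o \<times> 'a, ('o \<times> 'a) \<times> 'a \<times> ('o \<times> 'a)) category" where
  "module_category C M u m = action_category C M
    {(A, \<rho>). A \<in> Ob C \<and> \<rho> \<in> hom C (A \<odot>\<^bsub>C\<^esub> M) A \<and>
       \<rho> \<cdot>\<^bsub>C\<^esub> (\<rho> \<otimes>\<^bsub>C\<^esub> Id C M) = \<rho> \<cdot>\<^bsub>C\<^esub> (Id C A \<otimes>\<^bsub>C\<^esub> m) \<cdot>\<^bsub>C\<^esub> associator C A M M \<and>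
       \<rho> \<cdot>\<^bsub>C\<^esub> (Id C A \<otimes>\<^bsub>C\<^esub> u) = right_unitor C A}"

text \<open>The symmetry acts on \<open>(A \<odot> X) \<odot> X\<close> only after reassociation.\<close>

definition commuting_action_category ::
  "('o, 'a, 'z) sym_mon_data_scheme \<Rightarrow> 'o
    \<Rightarrow> ('o \<times> 'a, ('o \<times> 'a) \<times> 'a \<times> ('o \<times> 'a)) category" where
  "commuting_action_category C X = action_category C X
    {(A, \<alpha>). A \<in> Ob C \<and> \<alpha> \<in> hom C (A \<odot>\<^bsub>C\<^esub> X) A \<and>
       \<alpha> \<cdot>\<^bsub>C\<^esub> (\<alpha> \<otimes>\<^bsub>C\<^esub> Id C X) \<cdot>\<^bsub>C\<^esub>
         inv_arrow C (associator C A X X) \<cdot>\<^bsub>C\<^esub> (Id C A \<otimes>\<^bsub>C\<^esub> symmetry C X X) \<cdot>\<^bsub>C\<^esub> associator C A X X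
       = \<alpha> \<cdot>\<^bsub>C\<^esub> (\<alpha> \<otimes>\<^bsub>C\<^esub> Id C X)}"

definition restrict_action ::
  "('o, 'a, 'z) sym_mon_data_scheme \<Rightarrow> 'a \<Rightarrow> 'o \<times> 'a \<Rightarrow> 'o \<times> 'a" where
  "restrict_action C \<eta> = (\<lambda>(A, \<rho>). (A, \<rho> \<cdot>\<^bsub>C\<^esub> (Id C A \<otimes>\<^bsub>C\<^esub> \<eta>)))"

definition restriction_functor ::
  "('o, 'a, 'z) sym_mon_data_scheme \<Rightarrow> 'a
    \<Rightarrow> ('o \<times> 'a, ('o \<times> 'a) \<times> 'a \<times> ('o \<times> 'a),
        'o \<times> 'a, ('o \<times> 'a) \<times> 'a \<times> ('o \<times> 'a)) functor_data" where
  "restriction_functor C \<eta> = \<lparr>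
     ob_map = restrict_action C \<eta>,
     arr_map = (\<lambda>(a, f, b). (restrict_action C \<eta> a, f, restrict_action C \<eta> b))\<rparr>"

definition admits_algebraically_free_commutative_monoids ::
  "('o, 'a, 'z) sym_mon_data_scheme \<Rightarrow> bool" where
  "admits_algebraically_free_commutative_monoids C \<longleftrightarrow>
    (\<forall>X \<in> Ob C. \<exists>S u m \<eta>.
      free_commutative_monoid C X S u m \<eta> \<and>
      category_isomorphism (module_category C S u m) (commuting_action_category C X)
        (restriction_functor C \<eta>))"

end

theory Submission imports Defs begin

text \<open>
  Let \<open>S\<close> be the colimit of the tensor powers of \<open>X\<close>, with inclusions \<open>\<iota> n\<close>. The proof constructs
  the monoid structure of \<open>S\<close> without ever multiplying \<open>X\<^sup>m\<close> with \<open>X\<^sup>n\<close>: it first treats \<open>S\<close> as a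
  commuting action of \<open>X\<close>.

  Every permutation of factors is a composite of adjacent exchanges, so a cocone over the tensor
  powers is a family of arrows that absorbs adjacent exchanges (\<open>power_cocone\<close>,
  \<open>inclusion_swap\<close>). Because the colimit is preserved by tensoring with \<open>X\<close>, there is an action
  \<open>act : S \<odot> X \<rightarrow> S\<close> that appends one factor, and it commutes since \<open>\<iota> (n + 2)\<close> absorbs the exchange of
  the last two factors (\<open>commuting_act\<close>). Conversely, the iterates \<open>A \<odot> X\<^sup>n \<rightarrow> A\<close> of a commuting action
  \<open>\<alpha>\<close> on \<open>A\<close> absorb adjacent exchanges, and because the colimit is preserved by tensoring with \<open>A\<close>
  they glue to \<open>extension A \<alpha> : A \<odot> S \<rightarrow> A\<close>. This arrow respects the actions of \<open>X\<close>
  (\<open>extension_equivariant\<close>), and an equivariant arrow out of \<open>B \<odot> S\<close> is determined by its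
  restriction along the unit \<open>\<iota> 0\<close> (\<open>equivariant_eqI\<close>).

  The rest follows from this uniqueness principle. The multiplication of \<open>S\<close> is the extension of
  \<open>act\<close>. Associativity and the module law for \<open>extension A \<alpha>\<close> (\<open>extension_mult\<close>), the left unit law
  (\<open>mult_unit_left\<close>) and the compatibility of action maps with the extensions
  (\<open>action_map_extension\<close>) each compare two equivariant arrows with the same restriction along
  the unit. Commutativity (\<open>mult_sym\<close>) uses the commutation axiom once more: it
  makes \<open>\<alpha>\<close> itself equivariant, so that the actions of \<open>X\<close> and of \<open>S\<close> on \<open>A\<close> commute
  (\<open>extension_action_exchange\<close>). Restricting a module along \<open>eta\<close> gives a commuting action because
  \<open>S\<close> is commutative, and restriction and extension are mutually inverse (\<open>extension_eta\<close>,
  \<open>extension_restricted_action\<close>). Finally, a commutative monoid \<open>N\<close> with a map from \<open>X\<close> is a commuting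
  action, and monoid maps \<open>S \<rightarrow> N\<close> correspond to action maps that preserve the unit, of which there is
  exactly one (\<open>monoid_hom_of_action_map\<close>, \<open>action_map_unique\<close>, \<open>action_map_exists\<close>).
\<close>

section \<open>Calculating with composites\<close>

context category
begin

lemma in_hom_iff: "f \<in> hom C A B \<longleftrightarrow> f \<in> Arr C \<and> Dom C f = A \<and> Cod C f = B"
  by (simp add: hom_def)

lemma in_hom_Arr: "f \<in> Arr C \<Longrightarrow> f \<in> hom C (Dom C f) (Cod C f)"
  by (simp add: hom_def)

lemma comp_typing [simp]:
  assumes "f \<in> Arr C" "g \<in> Arr C" "Dom C g = Cod C f"
  shows "g \<cdot> f \<in> Arr C" "Dom C (g \<cdot> f) = Dom C f" "Cod C (g \<cdot> f) = Cod C g"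
  using Comp_hom[of f "Dom C f" "Cod C f" g "Cod C g"] assms by (simp_all add: hom_def)

lemma id_typing [simp]:
  assumes "A \<in> Ob C"
  shows "Id C A \<in> Arr C" "Dom C (Id C A) = A" "Cod C (Id C A) = A"
  using Id_hom[OF assms] by (simp_all add: hom_def)

lemma id_comp [simp]: "\<lbrakk>f \<in> Arr C; Cod C f = B\<rbrakk> \<Longrightarrow> Id C B \<cdot> f = f"
  using Id_Comp by (auto simp: hom_def)

lemma comp_id [simp]: "\<lbrakk>f \<in> Arr C; Dom C f = A\<rbrakk> \<Longrightarrow> f \<cdot> Id C A = f"
  using Comp_Id by (auto simp: hom_def)

lemma comp_assoc [simp]:
  assumes "f \<in> Arr C" "g \<in> Arr C" "h \<in> Arr C" "Dom C g = Cod C f" "Dom C h = Cod C g"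
  shows "(h \<cdot> g) \<cdot> f = h \<cdot> (g \<cdot> f)"
  by (rule Comp_assoc[of f "Dom C f" "Cod C f" g "Cod C g" h "Cod C h"]) (use assms in \<open>simp_all add: hom_def\<close>)

text \<open>Composites are kept bracketed to the right, so an equation between two-arrow composites does not
match inside a longer one. This rule extends \<open>g \<cdot> f = k\<close> by a tail.\<close>
lemma reassoc:
  assumes "g \<cdot> f = k" "f \<in> Arr C" "g \<in> Arr C" "Dom C g = Cod C f" "x \<in> Arr C" "Cod C x = Dom C f"
  shows "g \<cdot> (f \<cdot> x) = k \<cdot> x"
  using assms comp_assoc[of x f g] by simp

lemma inv_arrow_inverse:
  assumes "is_iso C f"
  shows "inverse_arrows C f (inv_arrow C f)"
proof -
  have "g = g'" if "inverse_arrows C f g" "inverse_arrows C f g'" for g g'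
  proof -
    have "g = (g' \<cdot> f) \<cdot> g" using that by (auto simp: inverse_arrows_def in_hom_iff)
    also have "\<dots> = g' \<cdot> (f \<cdot> g)"
      by (rule comp_assoc) (use that in \<open>auto simp: inverse_arrows_def in_hom_iff\<close>)
    also have "\<dots> = g'" using that by (auto simp: inverse_arrows_def in_hom_iff)
    finally show ?thesis .
  qed
  then show ?thesis
    using assms theI[of "inverse_arrows C f"] unfolding is_iso_def inv_arrow_def by metis
qed

lemma inv_arrow_iso:
  assumes "is_iso C f" "f \<in> hom C A B"
  shows "inv_arrow C f \<in> hom C B A" "inv_arrow C f \<cdot> f = Id C A" "f \<cdot> inv_arrow C f = Id C B"
  using inv_arrow_inverse[OF assms(1)] assms(2) by (auto simp: inverse_arrows_def in_hom_iff)

lemma inverse_arrows_sym: "inverse_arrows C f g \<Longrightarrow> inverse_arrows C g f"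
  by (auto simp: inverse_arrows_def in_hom_iff)

lemma iso_cancel_left:
  assumes "inverse_arrows C p q" "p \<cdot> f = p \<cdot> g"
    "f \<in> Arr C" "g \<in> Arr C" "Cod C f = Dom C p" "Cod C g = Dom C p"
  shows "f = g"
proof -
  have q: "q \<in> Arr C" "Dom C q = Cod C p" "Cod C q = Dom C p" "q \<cdot> p = Id C (Dom C p)" "p \<in> Arr C"
    using assms(1) by (auto simp: inverse_arrows_def in_hom_iff)
  have "q \<cdot> p \<cdot> f = q \<cdot> p \<cdot> g" using assms(2) by simp
  then show ?thesis using assms(3-6) q by (simp add: reassoc[OF q(4)])
qed

lemma iso_cancel_right:
  assumes "inverse_arrows C p q" "f \<cdot> p = g \<cdot> p"
    "f \<in> Arr C" "g \<in> Arr C" "Dom C f = Cod C p" "Dom C g = Cod C p"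
  shows "f = g"
proof -
  have q: "q \<in> Arr C" "Dom C q = Cod C p" "Cod C q = Dom C p" "p \<cdot> q = Id C (Cod C p)" "p \<in> Arr C"
    using assms(1) by (auto simp: inverse_arrows_def in_hom_iff)
  have "(f \<cdot> p) \<cdot> q = (g \<cdot> p) \<cdot> q" using assms(2) by simp
  then show ?thesis using assms(3-6) q by simp
qed

end

section \<open>Coherence in a symmetric monoidal category\<close>

context symmetric_monoidal_category
begin

abbreviation asc where "asc \<equiv> associator C"
abbreviation asc_inv where "asc_inv A B D \<equiv> inv_arrow C (associator C A B D)"
abbreviation lun where "lun \<equiv> left_unitor C"
abbreviation run where "run \<equiv> right_unitor C"
abbreviation lun_inv where "lun_inv A \<equiv> inv_arrow C (left_unitor C A)"
abbreviation sym where "sym \<equiv> symmetry C"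

lemmas [simp] = unit_Ob tensor_Ob tensor_Id

lemma tensor_typing [simp]:
  assumes "f \<in> Arr C" "g \<in> Arr C"
  shows "f \<otimes> g \<in> Arr C" "Dom C (f \<otimes> g) = Dom C f \<odot> Dom C g" "Cod C (f \<otimes> g) = Cod C f \<odot> Cod C g"
  using tensor_hom[OF in_hom_Arr in_hom_Arr, OF assms] by (simp_all add: in_hom_iff)

lemma interchange:
  assumes "f \<in> Arr C" "f' \<in> Arr C" "g \<in> Arr C" "g' \<in> Arr C" "Dom C f' = Cod C f" "Dom C g' = Cod C g"
  shows "(f' \<otimes> g') \<cdot> (f \<otimes> g) = (f' \<cdot> f) \<otimes> (g' \<cdot> g)"
  using tensor_Comp[of f "Dom C f" "Cod C f" f' "Cod C f'" g "Dom C g" "Cod C g" g' "Cod C g'"] assms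
  by (simp add: in_hom_iff)

lemma whisker_comp [simp]:
  assumes "f \<in> Arr C" "g \<in> Arr C" "Dom C g = Cod C f" "A \<in> Ob C"
  shows "(g \<cdot> f) \<otimes> Id C A = (g \<otimes> Id C A) \<cdot> (f \<otimes> Id C A)"
    and "Id C A \<otimes> (g \<cdot> f) = (Id C A \<otimes> g) \<cdot> (Id C A \<otimes> f)"
  using assms by (simp_all add: interchange)

lemma asc_typing [simp]:
  assumes "A \<in> Ob C" "B \<in> Ob C" "D \<in> Ob C"
  shows "asc A B D \<in> Arr C" "Dom C (asc A B D) = (A \<odot> B) \<odot> D" "Cod C (asc A B D) = A \<odot> (B \<odot> D)"
    "asc_inv A B D \<in> Arr C" "Dom C (asc_inv A B D) = A \<odot> (B \<odot> D)" "Cod C (asc_inv A B D) = (A \<odot> B) \<odot> D"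
  using inv_arrow_iso(1)[OF associator_iso associator_hom, OF assms assms] associator_hom[OF assms]
  by (simp_all add: in_hom_iff)

lemma asc_inverse [simp]:
  assumes "A \<in> Ob C" "B \<in> Ob C" "D \<in> Ob C"
  shows "asc_inv A B D \<cdot> asc A B D = Id C ((A \<odot> B) \<odot> D)" "asc A B D \<cdot> asc_inv A B D = Id C (A \<odot> (B \<odot> D))"
  using inv_arrow_iso(2,3)[OF associator_iso associator_hom, OF assms assms] .

lemma lun_typing [simp]:
  assumes "A \<in> Ob C"
  shows "lun A \<in> Arr C" "Dom C (lun A) = \<one> \<odot> A" "Cod C (lun A) = A"
    "lun_inv A \<in> Arr C" "Dom C (lun_inv A) = A" "Cod C (lun_inv A) = \<one> \<odot> A"
  using inv_arrow_iso(1)[OF left_unitor_iso left_unitor_hom, OF assms assms] left_unitor_hom[OF assms]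
  by (simp_all add: in_hom_iff)

lemma lun_inverse [simp]:
  assumes "A \<in> Ob C"
  shows "lun_inv A \<cdot> lun A = Id C (\<one> \<odot> A)" "lun A \<cdot> lun_inv A = Id C A"
  using inv_arrow_iso(2,3)[OF left_unitor_iso left_unitor_hom, OF assms assms] .

lemma run_typing [simp]:
  assumes "A \<in> Ob C"
  shows "run A \<in> Arr C" "Dom C (run A) = A \<odot> \<one>" "Cod C (run A) = A"
  using right_unitor_hom[OF assms] by (simp_all add: in_hom_iff)

lemma sym_typing [simp]:
  assumes "A \<in> Ob C" "B \<in> Ob C"
  shows "sym A B \<in> Arr C" "Dom C (sym A B) = A \<odot> B" "Cod C (sym A B) = B \<odot> A"
  using symmetry_hom[OF assms] by (simp_all add: in_hom_iff)

lemma iso_asc: "\<lbrakk>A \<in> Ob C; B \<in> Ob C; D \<in> Ob C\<rbrakk> \<Longrightarrow> inverse_arrows C (asc A B D) (asc_inv A B D)"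
  by (simp add: inverse_arrows_def in_hom_iff)

lemma iso_lun: "A \<in> Ob C \<Longrightarrow> inverse_arrows C (lun A) (lun_inv A)"
  by (simp add: inverse_arrows_def in_hom_iff)

lemma iso_run: "A \<in> Ob C \<Longrightarrow> inverse_arrows C (run A) (inv_arrow C (run A))"
  by (simp add: inv_arrow_inverse right_unitor_iso)

lemma iso_sym: "\<lbrakk>A \<in> Ob C; B \<in> Ob C\<rbrakk> \<Longrightarrow> inverse_arrows C (sym A B) (sym B A)"
  by (simp add: inverse_arrows_def in_hom_iff symmetry_involutive)

lemma iso_tensor:
  assumes "inverse_arrows C p q" "inverse_arrows C p' q'"
  shows "inverse_arrows C (p \<otimes> p') (q \<otimes> q')"
  using assms by (auto simp: inverse_arrows_def in_hom_iff interchange dom_in_Ob cod_in_Ob)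

lemma iso_id: "A \<in> Ob C \<Longrightarrow> inverse_arrows C (Id C A) (Id C A)"
  by (simp add: inverse_arrows_def in_hom_iff)

lemma whisker_exchange:
  "\<lbrakk>f \<in> Arr C; g \<in> Arr C; A = Dom C f; B = Cod C g\<rbrakk>
    \<Longrightarrow> (f \<otimes> Id C B) \<cdot> (Id C A \<otimes> g) = (Id C (Cod C f) \<otimes> g) \<cdot> (f \<otimes> Id C (Dom C g))"
  by (simp add: interchange dom_in_Ob cod_in_Ob)

lemma asc_natural:
  "\<lbrakk>f \<in> Arr C; g \<in> Arr C; h \<in> Arr C; A = Cod C f; B = Cod C g; D = Cod C h\<rbrakk>
    \<Longrightarrow> asc A B D \<cdot> ((f \<otimes> g) \<otimes> h) = (f \<otimes> (g \<otimes> h)) \<cdot> asc (Dom C f) (Dom C g) (Dom C h)"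
  using associator_natural[OF in_hom_Arr in_hom_Arr in_hom_Arr] by simp

lemma lun_natural: "\<lbrakk>f \<in> Arr C; A = Cod C f\<rbrakk> \<Longrightarrow> lun A \<cdot> (Id C \<one> \<otimes> f) = f \<cdot> lun (Dom C f)"
  using left_unitor_natural[OF in_hom_Arr] by simp

lemma lun_inv_natural:
  assumes "f \<in> Arr C" "A = Cod C f"
  shows "lun_inv A \<cdot> f = (Id C \<one> \<otimes> f) \<cdot> lun_inv (Dom C f)"
proof (rule iso_cancel_left[OF iso_lun[of A]])
  note [simp] = dom_in_Ob cod_in_Ob
  show "lun A \<cdot> lun_inv A \<cdot> f = lun A \<cdot> (Id C \<one> \<otimes> f) \<cdot> lun_inv (Dom C f)"
    using assms by (simp add: reassoc[OF lun_inverse(2)] reassoc[OF lun_natural])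
qed (use assms in \<open>simp_all add: dom_in_Ob cod_in_Ob\<close>)

lemma run_natural: "\<lbrakk>f \<in> Arr C; A = Cod C f\<rbrakk> \<Longrightarrow> run A \<cdot> (f \<otimes> Id C \<one>) = f \<cdot> run (Dom C f)"
  using right_unitor_natural[OF in_hom_Arr] by simp

lemma sym_natural:
  "\<lbrakk>f \<in> Arr C; g \<in> Arr C; A = Cod C f; B = Cod C g\<rbrakk>
    \<Longrightarrow> sym A B \<cdot> (f \<otimes> g) = (g \<otimes> f) \<cdot> sym (Dom C f) (Dom C g)"
  using symmetry_natural[OF in_hom_Arr in_hom_Arr] by simp

lemma tensor_unit_left_faithful:
  assumes "Id C \<one> \<otimes> f = Id C \<one> \<otimes> g" "f \<in> Arr C" "g \<in> Arr C" "Dom C f = Dom C g" "Cod C f = Cod C g"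
  shows "f = g"
proof (rule iso_cancel_right[OF iso_lun])
  show "f \<cdot> lun (Dom C f) = g \<cdot> lun (Dom C f)"
    using lun_natural[of f] lun_natural[of g] assms by simp
qed (use assms in \<open>simp_all add: dom_in_Ob\<close>)

lemma tensor_unit_right_faithful:
  assumes "f \<otimes> Id C \<one> = g \<otimes> Id C \<one>" "f \<in> Arr C" "g \<in> Arr C" "Dom C f = Dom C g" "Cod C f = Cod C g"
  shows "f = g"
proof (rule iso_cancel_right[OF iso_run])
  show "f \<cdot> run (Dom C f) = g \<cdot> run (Dom C f)"
    using run_natural[of f] run_natural[of g] assms by simp
qed (use assms in \<open>simp_all add: dom_in_Ob\<close>)

text \<open>Kelly's argument: after tensoring with the unit on the left, both sides extend to the pentagon for
\<open>\<one>, \<one>, A, B\<close>, whose unit can be removed by the triangle in two ways; tensoring with the unit is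
faithful because the unitors are natural isomorphisms.\<close>
lemma lun_tensor:
  assumes "A \<in> Ob C" "B \<in> Ob C"
  shows "lun (A \<odot> B) \<cdot> asc \<one> A B = lun A \<otimes> Id C B"
proof (rule tensor_unit_left_faithful)
  show "Id C \<one> \<otimes> (lun (A \<odot> B) \<cdot> asc \<one> A B) = Id C \<one> \<otimes> (lun A \<otimes> Id C B)"
  proof (rule iso_cancel_right[OF iso_asc])
    show "(Id C \<one> \<otimes> (lun (A \<odot> B) \<cdot> asc \<one> A B)) \<cdot> asc \<one> (\<one> \<odot> A) B
        = (Id C \<one> \<otimes> (lun A \<otimes> Id C B)) \<cdot> asc \<one> (\<one> \<odot> A) B"
    proof (rule iso_cancel_right[OF iso_tensor[OF iso_asc iso_id]])
      have "((Id C \<one> \<otimes> (lun (A \<odot> B) \<cdot> asc \<one> A B)) \<cdot> asc \<one> (\<one> \<odot> A) B) \<cdot> (asc \<one> \<one> A \<otimes> Id C B)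
         = (Id C \<one> \<otimes> lun (A \<odot> B)) \<cdot> asc \<one> \<one> (A \<odot> B) \<cdot> asc (\<one> \<odot> \<one>) A B"
        using assms by (simp add: pentagon)
      also have "\<dots> = (run \<one> \<otimes> Id C (A \<odot> B)) \<cdot> asc (\<one> \<odot> \<one>) A B"
        using assms by (simp add: reassoc[OF triangle])
      also have "\<dots> = asc \<one> A B \<cdot> ((run \<one> \<otimes> Id C A) \<otimes> Id C B)"
        using assms by (simp add: asc_natural)
      also have "\<dots> = asc \<one> A B \<cdot> ((Id C \<one> \<otimes> lun A) \<otimes> Id C B) \<cdot> (asc \<one> \<one> A \<otimes> Id C B)"
        using assms by (simp flip: triangle)
      also have "\<dots> = ((Id C \<one> \<otimes> (lun A \<otimes> Id C B)) \<cdot> asc \<one> (\<one> \<odot> A) B) \<cdot> (asc \<one> \<one> A \<otimes> Id C B)"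
        using assms by (simp add: reassoc[OF asc_natural])
      finally show "((Id C \<one> \<otimes> (lun (A \<odot> B) \<cdot> asc \<one> A B)) \<cdot> asc \<one> (\<one> \<odot> A) B) \<cdot> (asc \<one> \<one> A \<otimes> Id C B)
        = \<dots>" .
    qed (use assms in simp_all)
  qed (use assms in simp_all)
qed (use assms in simp_all)

lemma lun_inv_tensor:
  assumes "A \<in> Ob C" "B \<in> Ob C"
  shows "asc \<one> A B \<cdot> (lun_inv A \<otimes> Id C B) = lun_inv (A \<odot> B)"
proof (rule iso_cancel_left[OF iso_lun[of "A \<odot> B"]])
  show "lun (A \<odot> B) \<cdot> asc \<one> A B \<cdot> (lun_inv A \<otimes> Id C B) = lun (A \<odot> B) \<cdot> lun_inv (A \<odot> B)"
    using assms by (simp add: reassoc[OF lun_tensor] interchange)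
qed (use assms in simp_all)

text \<open>The mirror image of \<open>lun_tensor\<close>, from the pentagon for \<open>A, B, \<one>, \<one>\<close>.\<close>
lemma run_tensor:
  assumes "A \<in> Ob C" "B \<in> Ob C"
  shows "(Id C A \<otimes> run B) \<cdot> asc A B \<one> = run (A \<odot> B)"
proof (rule tensor_unit_right_faithful)
  show "((Id C A \<otimes> run B) \<cdot> asc A B \<one>) \<otimes> Id C \<one> = run (A \<odot> B) \<otimes> Id C \<one>"
  proof (rule iso_cancel_left[OF iso_asc])
    have "asc A B \<one> \<cdot> ((Id C A \<otimes> run B) \<cdot> asc A B \<one>) \<otimes> Id C \<one>
      = (Id C A \<otimes> (run B \<otimes> Id C \<one>)) \<cdot> asc A (B \<odot> \<one>) \<one> \<cdot> (asc A B \<one> \<otimes> Id C \<one>)"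
      using assms by (simp add: reassoc[OF asc_natural])
    also have "\<dots> = (Id C A \<otimes> (Id C B \<otimes> lun \<one>)) \<cdot> (Id C A \<otimes> asc B \<one> \<one>) \<cdot> asc A (B \<odot> \<one>) \<one> \<cdot> (asc A B \<one> \<otimes> Id C \<one>)"
      using assms by (simp flip: triangle)
    also have "\<dots> = (Id C A \<otimes> (Id C B \<otimes> lun \<one>)) \<cdot> asc A B (\<one> \<odot> \<one>) \<cdot> asc (A \<odot> B) \<one> \<one>"
      using assms by (simp add: pentagon)
    also have "\<dots> = asc A B \<one> \<cdot> (Id C (A \<odot> B) \<otimes> lun \<one>) \<cdot> asc (A \<odot> B) \<one> \<one>"
      using assms by (simp add: reassoc[OF asc_natural] flip: tensor_Id)
    also have "\<dots> = asc A B \<one> \<cdot> (run (A \<odot> B) \<otimes> Id C \<one>)"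
      using assms by (simp add: triangle)
    finally show "asc A B \<one> \<cdot> ((Id C A \<otimes> run B) \<cdot> asc A B \<one>) \<otimes> Id C \<one> = asc A B \<one> \<cdot> (run (A \<odot> B) \<otimes> Id C \<one>)" .
  qed (use assms in simp_all)
qed (use assms in simp_all)

text \<open>Naturality of the left unitor at itself gives \<open>lun (\<one> \<odot> \<one>) = Id \<otimes> lun \<one>\<close>; hence
\<open>lun_tensor\<close> and the triangle express \<open>lun \<one> \<otimes> Id\<close> and \<open>run \<one> \<otimes> Id\<close> by the same composite.\<close>
lemma lun_unit_eq_run_unit: "lun \<one> = run \<one>"
proof (rule tensor_unit_right_faithful)
  have "lun (\<one> \<odot> \<one>) = Id C \<one> \<otimes> lun \<one>"
    by (rule iso_cancel_left[OF iso_lun[of \<one>]]) (simp_all add: lun_natural)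
  then show "lun \<one> \<otimes> Id C \<one> = run \<one> \<otimes> Id C \<one>"
    using lun_tensor[of \<one> \<one>] triangle[of \<one> \<one>] by simp
qed simp_all

text \<open>Joyal and Street's argument: the hexagon for \<open>A, \<one>, \<one>\<close> followed by the left unitor reduces, by
naturality and \<open>lun_tensor\<close>, to this equation tensored with the unit.\<close>
lemma lun_sym:
  assumes "A \<in> Ob C"
  shows "lun A \<cdot> sym A \<one> = run A"
proof (rule tensor_unit_right_faithful)
  show "(lun A \<cdot> sym A \<one>) \<otimes> Id C \<one> = run A \<otimes> Id C \<one>"
  proof (rule iso_cancel_left[OF iso_sym])
    have "sym A \<one> \<cdot> ((lun A \<cdot> sym A \<one>) \<otimes> Id C \<one>)
        = sym A \<one> \<cdot> lun (A \<odot> \<one>) \<cdot> asc \<one> A \<one> \<cdot> (sym A \<one> \<otimes> Id C \<one>)"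
      using assms by (simp add: reassoc[OF lun_tensor])
    also have "\<dots> = lun (\<one> \<odot> A) \<cdot> (Id C \<one> \<otimes> sym A \<one>) \<cdot> asc \<one> A \<one> \<cdot> (sym A \<one> \<otimes> Id C \<one>)"
      using assms by (simp add: reassoc[OF lun_natural])
    also have "\<dots> = lun (\<one> \<odot> A) \<cdot> asc \<one> \<one> A \<cdot> sym A (\<one> \<odot> \<one>) \<cdot> asc A \<one> \<one>"
      using assms by (simp add: hexagon)
    also have "\<dots> = (lun \<one> \<otimes> Id C A) \<cdot> sym A (\<one> \<odot> \<one>) \<cdot> asc A \<one> \<one>"
      using assms by (simp add: reassoc[OF lun_tensor])
    also have "\<dots> = sym A \<one> \<cdot> (Id C A \<otimes> lun \<one>) \<cdot> asc A \<one> \<one>"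
      using assms by (simp add: reassoc[OF sym_natural])
    also have "\<dots> = sym A \<one> \<cdot> (run A \<otimes> Id C \<one>)"
      using assms by (simp add: triangle)
    finally show "sym A \<one> \<cdot> ((lun A \<cdot> sym A \<one>) \<otimes> Id C \<one>) = sym A \<one> \<cdot> (run A \<otimes> Id C \<one>)" .
  qed (use assms in simp_all)
qed (use assms in \<open>simp_all add: in_hom_iff\<close>)

lemma asc_cancel [simp]:
  assumes "A \<in> Ob C" "B \<in> Ob C" "D \<in> Ob C" "x \<in> Arr C"
  shows "Cod C x = (A \<odot> B) \<odot> D \<Longrightarrow> asc_inv A B D \<cdot> asc A B D \<cdot> x = x"
    "Cod C x = A \<odot> (B \<odot> D) \<Longrightarrow> asc A B D \<cdot> asc_inv A B D \<cdot> x = x"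
    "\<lbrakk>Cod C x = ((A \<odot> B) \<odot> D) \<odot> E; E \<in> Ob C\<rbrakk>
      \<Longrightarrow> (asc_inv A B D \<otimes> Id C E) \<cdot> (asc A B D \<otimes> Id C E) \<cdot> x = x"
  using assms by (simp_all add: reassoc[OF asc_inverse(1)] reassoc[OF asc_inverse(2)] reassoc[OF interchange])

lemma asc_inv_natural:
  assumes "f \<in> Arr C" "g \<in> Arr C" "h \<in> Arr C" "A = Dom C f" "B = Dom C g" "D = Dom C h"
  shows "asc_inv (Cod C f) (Cod C g) (Cod C h) \<cdot> (f \<otimes> (g \<otimes> h)) = ((f \<otimes> g) \<otimes> h) \<cdot> asc_inv A B D"
proof (rule iso_cancel_right[OF iso_asc[of A B D]])
  note [simp] = dom_in_Ob cod_in_Ob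
  show "(asc_inv (Cod C f) (Cod C g) (Cod C h) \<cdot> (f \<otimes> (g \<otimes> h))) \<cdot> asc A B D
    = (((f \<otimes> g) \<otimes> h) \<cdot> asc_inv A B D) \<cdot> asc A B D"
    using assms by (simp flip: asc_natural)
qed (use assms in \<open>simp_all add: dom_in_Ob cod_in_Ob\<close>)

section \<open>Exchanging two right-hand factors\<close>

text \<open>The symmetry of \<open>X\<close> and \<open>Y\<close> as a natural isomorphism between iterated right tensor products,
\<open>(A \<odot> X) \<odot> Y \<rightarrow> (A \<odot> Y) \<odot> X\<close>. With \<open>Y = X\<close> it occurs both in the commutation axiom for actions and in
the arrows that permute the factors of a tensor power. The coherence laws below package
the pentagon and the hexagon for both.\<close>
definition exchange where
  "exchange A X Y = asc_inv A Y X \<cdot> (Id C A \<otimes> sym X Y) \<cdot> asc A X Y"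

lemma exchange_typing [simp]:
  assumes "A \<in> Ob C" "X \<in> Ob C" "Y \<in> Ob C"
  shows "exchange A X Y \<in> Arr C" "Dom C (exchange A X Y) = (A \<odot> X) \<odot> Y"
    "Cod C (exchange A X Y) = (A \<odot> Y) \<odot> X"
  using assms by (simp_all add: exchange_def)

lemma asc_exchange:
  assumes "A \<in> Ob C" "X \<in> Ob C" "Y \<in> Ob C"
  shows "asc A Y X \<cdot> exchange A X Y = (Id C A \<otimes> sym X Y) \<cdot> asc A X Y"
  using assms by (simp add: exchange_def reassoc[OF asc_inverse(2)])

lemma exchange_natural:
  assumes "f \<in> Arr C" "g \<in> Arr C" "h \<in> Arr C" "A = Cod C f" "X = Cod C g" "Y = Cod C h"
  shows "exchange A X Y \<cdot> ((f \<otimes> g) \<otimes> h) = ((f \<otimes> h) \<otimes> g) \<cdot> exchange (Dom C f) (Dom C g) (Dom C h)"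
proof (rule iso_cancel_left[OF iso_asc])
  note [simp] = dom_in_Ob cod_in_Ob
  have "asc A Y X \<cdot> exchange A X Y \<cdot> ((f \<otimes> g) \<otimes> h)
    = (Id C A \<otimes> sym X Y) \<cdot> (f \<otimes> (g \<otimes> h)) \<cdot> asc (Dom C f) (Dom C g) (Dom C h)"
    using assms by (simp add: reassoc[OF asc_exchange] asc_natural)
  also have "\<dots> = (f \<otimes> (h \<otimes> g)) \<cdot> (Id C (Dom C f) \<otimes> sym (Dom C g) (Dom C h)) \<cdot> asc (Dom C f) (Dom C g) (Dom C h)"
    using assms by (simp add: reassoc[OF interchange] sym_natural)
  also have "\<dots> = asc A Y X \<cdot> ((f \<otimes> h) \<otimes> g) \<cdot> exchange (Dom C f) (Dom C g) (Dom C h)"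
    using assms by (simp add: reassoc[OF asc_natural] asc_exchange)
  finally show "asc A Y X \<cdot> exchange A X Y \<cdot> ((f \<otimes> g) \<otimes> h)
    = asc A Y X \<cdot> ((f \<otimes> h) \<otimes> g) \<cdot> exchange (Dom C f) (Dom C g) (Dom C h)" .
qed (use assms in \<open>simp_all add: cod_in_Ob dom_in_Ob\<close>)

lemma exchange_involutive:
  assumes "A \<in> Ob C" "X \<in> Ob C" "Y \<in> Ob C"
  shows "exchange A Y X \<cdot> exchange A X Y = Id C ((A \<odot> X) \<odot> Y)"
proof (rule iso_cancel_left[OF iso_asc])
  show "asc A X Y \<cdot> exchange A Y X \<cdot> exchange A X Y = asc A X Y \<cdot> Id C ((A \<odot> X) \<odot> Y)"
    using assms
    by (simp add: reassoc[OF asc_exchange] asc_exchange reassoc[OF interchange] symmetry_involutive)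
qed (use assms in simp_all)

lemma exchange_unit:
  assumes "A \<in> Ob C" "X \<in> Ob C"
  shows "(run A \<otimes> Id C X) \<cdot> exchange A X \<one> = run (A \<odot> X)"
proof -
  have "(run A \<otimes> Id C X) \<cdot> exchange A X \<one> = (Id C A \<otimes> lun X) \<cdot> asc A \<one> X \<cdot> exchange A X \<one>"
    using assms by (simp add: reassoc[OF triangle])
  also have "\<dots> = (Id C A \<otimes> (lun X \<cdot> sym X \<one>)) \<cdot> asc A X \<one>"
    using assms by (simp add: asc_exchange)
  also have "\<dots> = run (A \<odot> X)"
    using assms by (simp only: lun_sym run_tensor)
  finally show ?thesis .
qed

text \<open>The hexagon in terms of \<open>exchange\<close>: exchanging \<open>X\<close> with \<open>Y \<odot> Z\<close> means exchanging it with \<open>Y\<close> and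
then with \<open>Z\<close>. Both sides become equal after composing with the associators that move all
brackets to the right.\<close>
lemma exchange_tensor:
  assumes "A \<in> Ob C" "X \<in> Ob C" "Y \<in> Ob C" "Z \<in> Ob C"
  shows "exchange A X (Y \<odot> Z) \<cdot> asc (A \<odot> X) Y Z
    = (asc A Y Z \<otimes> Id C X) \<cdot> exchange (A \<odot> Y) X Z \<cdot> (exchange A X Y \<otimes> Id C Z)"
proof (rule iso_cancel_left[OF iso_asc])
  show "asc A (Y \<odot> Z) X \<cdot> exchange A X (Y \<odot> Z) \<cdot> asc (A \<odot> X) Y Z
    = asc A (Y \<odot> Z) X \<cdot> (asc A Y Z \<otimes> Id C X) \<cdot> exchange (A \<odot> Y) X Z \<cdot> (exchange A X Y \<otimes> Id C Z)"
    (is "?l = ?r")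
  proof (rule iso_cancel_left[OF iso_tensor[OF iso_id iso_asc]])
    have "(Id C A \<otimes> asc Y Z X) \<cdot> ?l
      = (Id C A \<otimes> asc Y Z X) \<cdot> (Id C A \<otimes> sym X (Y \<odot> Z)) \<cdot> asc A X (Y \<odot> Z) \<cdot> asc (A \<odot> X) Y Z"
      using assms by (simp add: reassoc[OF asc_exchange])
    also have "\<dots> = (Id C A \<otimes> (asc Y Z X \<cdot> sym X (Y \<odot> Z) \<cdot> asc X Y Z)) \<cdot> asc A (X \<odot> Y) Z \<cdot> (asc A X Y \<otimes> Id C Z)"
      using assms by (simp flip: pentagon)
    also have "\<dots> = (Id C A \<otimes> (Id C Y \<otimes> sym X Z)) \<cdot> (Id C A \<otimes> asc Y X Z) \<cdot> (Id C A \<otimes> (sym X Y \<otimes> Id C Z)) \<cdot> asc A (X \<odot> Y) Z \<cdot> (asc A X Y \<otimes> Id C Z)"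
      using assms by (simp only: hexagon) simp
    also have "\<dots> = (Id C A \<otimes> (Id C Y \<otimes> sym X Z)) \<cdot> (Id C A \<otimes> asc Y X Z) \<cdot> asc A (Y \<odot> X) Z \<cdot> ((Id C A \<otimes> sym X Y) \<otimes> Id C Z) \<cdot> (asc A X Y \<otimes> Id C Z)"
      using assms by (simp add: reassoc[OF asc_natural])
    also have "\<dots> = (Id C A \<otimes> (Id C Y \<otimes> sym X Z)) \<cdot> (Id C A \<otimes> asc Y X Z) \<cdot> asc A (Y \<odot> X) Z \<cdot> (asc A Y X \<otimes> Id C Z) \<cdot> (exchange A X Y \<otimes> Id C Z)"
      using assms by (simp add: asc_exchange flip: whisker_comp(1))
    also have "\<dots> = (Id C A \<otimes> (Id C Y \<otimes> sym X Z)) \<cdot> asc A Y (X \<odot> Z) \<cdot> asc (A \<odot> Y) X Z \<cdot> (exchange A X Y \<otimes> Id C Z)"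
      using assms reassoc[OF pentagon[of A Y X Z], of "exchange A X Y \<otimes> Id C Z"] by simp
    also have "\<dots> = asc A Y (Z \<odot> X) \<cdot> (Id C (A \<odot> Y) \<otimes> sym X Z) \<cdot> asc (A \<odot> Y) X Z \<cdot> (exchange A X Y \<otimes> Id C Z)"
      using assms by (simp add: reassoc[OF asc_natural] flip: tensor_Id)
    also have "\<dots> = asc A Y (Z \<odot> X) \<cdot> asc (A \<odot> Y) Z X \<cdot> exchange (A \<odot> Y) X Z \<cdot> (exchange A X Y \<otimes> Id C Z)"
      using assms by (simp add: reassoc[OF asc_exchange])
    also have "\<dots> = (Id C A \<otimes> asc Y Z X) \<cdot> ?r"
      using assms reassoc[OF pentagon[of A Y Z X], of "exchange (A \<odot> Y) X Z \<cdot> (exchange A X Y \<otimes> Id C Z)"] by simp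
    finally show "(Id C A \<otimes> asc Y Z X) \<cdot> ?l = (Id C A \<otimes> asc Y Z X) \<cdot> ?r" .
  qed (use assms in simp_all)
qed (use assms in simp_all)

text \<open>Tensoring with \<open>A\<close> on the left commutes with exchanging the last two factors. The pentagon moves
\<open>A\<close> across the two factors on either side.\<close>
lemma tensor_exchange:
  assumes "A \<in> Ob C" "P \<in> Ob C" "X \<in> Ob C" "Y \<in> Ob C"
  shows "(Id C A \<otimes> exchange P X Y) \<cdot> asc A (P \<odot> X) Y \<cdot> (asc A P X \<otimes> Id C Y)
    = asc A (P \<odot> Y) X \<cdot> (asc A P Y \<otimes> Id C X) \<cdot> exchange (A \<odot> P) X Y"
    (is "?l = ?r")
proof (rule iso_cancel_left[OF iso_tensor[OF iso_id iso_asc]])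
  have "(Id C A \<otimes> asc P Y X) \<cdot> ?l = (Id C A \<otimes> (asc P Y X \<cdot> exchange P X Y)) \<cdot> asc A (P \<odot> X) Y \<cdot> (asc A P X \<otimes> Id C Y)"
    using assms by simp
  also have "\<dots> = (Id C A \<otimes> (Id C P \<otimes> sym X Y)) \<cdot> (Id C A \<otimes> asc P X Y) \<cdot> asc A (P \<odot> X) Y \<cdot> (asc A P X \<otimes> Id C Y)"
    using assms by (simp only: asc_exchange) simp
  also have "\<dots> = (Id C A \<otimes> (Id C P \<otimes> sym X Y)) \<cdot> asc A P (X \<odot> Y) \<cdot> asc (A \<odot> P) X Y"
    using assms by (simp add: pentagon)
  also have "\<dots> = asc A P (Y \<odot> X) \<cdot> (Id C (A \<odot> P) \<otimes> sym X Y) \<cdot> asc (A \<odot> P) X Y"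
    using assms by (simp add: reassoc[OF asc_natural] flip: tensor_Id)
  also have "\<dots> = asc A P (Y \<odot> X) \<cdot> asc (A \<odot> P) Y X \<cdot> exchange (A \<odot> P) X Y"
    using assms by (simp add: asc_exchange)
  also have "\<dots> = (Id C A \<otimes> asc P Y X) \<cdot> ?r"
    using assms reassoc[OF pentagon[of A P Y X], of "exchange (A \<odot> P) X Y"] by simp
  finally show "(Id C A \<otimes> asc P Y X) \<cdot> ?l = (Id C A \<otimes> asc P Y X) \<cdot> ?r" .
qed (use assms in simp_all)


lemma tensor_exchange_inv:
  assumes "A \<in> Ob C" "P \<in> Ob C" "X \<in> Ob C" "Y \<in> Ob C"
  shows "(asc_inv A P Y \<otimes> Id C X) \<cdot> asc_inv A (P \<odot> Y) X \<cdot> (Id C A \<otimes> exchange P X Y)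
    = exchange (A \<odot> P) X Y \<cdot> (asc_inv A P X \<otimes> Id C Y) \<cdot> asc_inv A (P \<odot> X) Y"
    (is "?l = ?r")
proof (rule iso_cancel_right[OF iso_asc])
  show "?l \<cdot> asc A (P \<odot> X) Y = ?r \<cdot> asc A (P \<odot> X) Y"
  proof (rule iso_cancel_right[OF iso_tensor[OF iso_asc iso_id]])
    show "(?l \<cdot> asc A (P \<odot> X) Y) \<cdot> (asc A P X \<otimes> Id C Y) = (?r \<cdot> asc A (P \<odot> X) Y) \<cdot> (asc A P X \<otimes> Id C Y)"
      using assms by (simp add: tensor_exchange interchange)
  qed (use assms in simp_all)
qed (use assms in simp_all)

section \<open>Cocones over the tensor powers\<close>

lemma tensor_power_Ob [simp]: "X \<in> Ob C \<Longrightarrow> tensor_power C X n \<in> Ob C"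
  by (induction n) simp_all

text \<open>Every other adjacent exchange on \<open>X\<^sup>n\<^sup>+\<^sup>2\<close> is one on \<open>X\<^sup>n\<^sup>+\<^sup>1\<close> tensored with \<open>X\<close>. So in inductions on
the number of factors, this is the case that calls for the commutation axiom.\<close>
lemma swap_factors_last: "swap_factors C X n (Suc (Suc n)) = exchange (tensor_power C X n) X X"
  by (simp add: exchange_def)

lemma swap_factors_typing [simp]:
  assumes "X \<in> Ob C" "Suc i < n"
  shows "swap_factors C X i n \<in> Arr C" "Dom C (swap_factors C X i n) = tensor_power C X n"
    "Cod C (swap_factors C X i n) = tensor_power C X n"
  using assms(2)
proof (induction n)
  case (Suc n)
  have step: "swap_factors C X i (Suc n)
    = (if Suc i = n then exchange (tensor_power C X i) X X else swap_factors C X i n \<otimes> Id C X)"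
    by (simp add: exchange_def)
  {
    case 1
    then show ?case using Suc.IH assms(1) by (simp add: step del: swap_factors.simps)
  next
    case 2
    then show ?case using Suc.IH assms(1) by (auto simp add: step simp del: swap_factors.simps)
  next
    case 3
    then show ?case using Suc.IH assms(1) by (auto simp add: step simp del: swap_factors.simps)
  }
qed simp_all

text \<open>Cocones over the tensor powers are governed by the adjacent exchanges alone: each
\<open>permute_factors\<close> is a composite of them, and each of them is \<open>permute_factors\<close> of a
transposition.\<close>
inductive_set swap_composites for X n where
  id_swap_composite: "Id C (tensor_power C X n) \<in> swap_composites X n"
| swap_swap_composite: "\<lbrakk>g \<in> swap_composites X n; Suc i < n\<rbrakk>
    \<Longrightarrow> swap_factors C X i n \<cdot> g \<in> swap_composites X n"

lemma swap_composite_typing: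
  assumes "g \<in> swap_composites X n" "X \<in> Ob C"
  shows "g \<in> hom C (tensor_power C X n) (tensor_power C X n)"
  using assms by induction (simp_all add: in_hom_iff)

lemma swap_composite_tensor:
  assumes "g \<in> swap_composites X n" "X \<in> Ob C"
  shows "g \<otimes> Id C X \<in> swap_composites X (Suc n)"
  using assms
proof induction
  case id_swap_composite
  then show ?case using swap_composites.id_swap_composite[of X "Suc n"] by simp
next
  case (swap_swap_composite g i)
  then show ?case
    using swap_composite_typing[OF swap_swap_composite.hyps(1)]
      swap_composites.swap_swap_composite[of "g \<otimes> Id C X" X "Suc n" i]
    by (simp add: in_hom_iff)
qed

text \<open>The composites are closed under tensoring with \<open>X\<close>, which takes care of the permutation of the
first \<open>n\<close> factors; the cycle moving the last factor to its place is a composite by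
construction.\<close>
lemma permute_factors_swap_composite:
  assumes "X \<in> Ob C"
  shows "permute_factors C X n \<sigma> \<in> swap_composites X n"
proof (induction n arbitrary: \<sigma>)
  case 0
  then show ?case using id_swap_composite[of X 0] by simp
next
  case (Suc n)
  \<comment> \<open>The second conjunct supplies the typing of the shorter fold in the induction on \<open>is\<close>.\<close>
  have "foldr (\<lambda>i g. swap_factors C X i (Suc n) \<cdot> g) is (Id C (tensor_power C X (Suc n))) \<cdot> h
      \<in> swap_composites X (Suc n) \<and>
    foldr (\<lambda>i g. swap_factors C X i (Suc n) \<cdot> g) is (Id C (tensor_power C X (Suc n)))
      \<in> swap_composites X (Suc n)"
    if "set is \<subseteq> {..<n}" "h \<in> swap_composites X (Suc n)" for "is" h
    using that(1)
  proof (induction "is")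
    case Nil
    then show ?case using that(2) swap_composite_typing[OF that(2) assms] assms
        id_swap_composite[of X "Suc n"]
      by (simp add: in_hom_iff)
  next
    case (Cons i "is")
    then show ?case
      using that(2)[THEN swap_composite_typing, OF assms] assms
        swap_composite_typing[of "foldr (\<lambda>i g. swap_factors C X i (Suc n) \<cdot> g) is (Id C (tensor_power C X (Suc n)))" X "Suc n"]
        swap_swap_composite[of _ X "Suc n" i]
      by (simp add: in_hom_iff del: swap_factors.simps)
  qed
  from this[THEN conjunct1] show ?case
    using swap_composite_tensor[OF Suc.IH assms] by (simp del: swap_factors.simps add: subset_iff)
qed

lemma permute_factors_id:
  assumes "X \<in> Ob C"
  shows "permute_factors C X n id = Id C (tensor_power C X n)"
proof (induction n)
  case (Suc n)
  have "(\<lambda>i. if i < n then if id n < id i then id i - 1 else id i else i) = id"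
    by auto
  then show ?case
    using Suc assms by (simp only: permute_factors.simps) simp
qed simp

text \<open>If \<open>i + 1\<close> is the last position, the squeezed permutation is the identity and the cycle consists
of one exchange; otherwise the cycle is empty.\<close>
lemma permute_factors_transpose:
  assumes "X \<in> Ob C" "Suc i < n"
  shows "permute_factors C X n (Transposition.transpose i (Suc i)) = swap_factors C X i n"
  using assms(2)
proof (induction n)
  case (Suc n)
  let ?\<tau> = "Transposition.transpose i (Suc i)"
  let ?\<tau>' = "\<lambda>j. if j < n then if ?\<tau> n < ?\<tau> j then ?\<tau> j - 1 else ?\<tau> j else j"
  show ?case
  proof (cases "Suc i = n")
    case True
    then have "?\<tau>' = id"
      by (auto simp: fun_eq_iff Transposition.transpose_def)
    moreover have "[i..<n] = [i]"
      using True by auto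
    moreover have "?\<tau> n = i"
      using True by simp
    ultimately show ?thesis
      using assms(1) swap_factors_typing[OF assms(1) Suc.prems]
      by (simp only: permute_factors.simps permute_factors_id)
        (simp del: swap_factors.simps flip: tensor_power.simps)
  next
    case False
    then have "?\<tau>' = ?\<tau>" and "?\<tau> n = n"
      using Suc.prems by (auto simp: fun_eq_iff Transposition.transpose_def)
    then show ?thesis
      using False Suc assms(1) by simp
  qed
qed simp

end

context category
begin

text \<open>Two arrows that agree on the inclusions factor one and the same cocone; that this is a cocone uses
the typing of the diagram.\<close>
lemma colimit_jointly_epic:
  assumes "is_colimit J C F L \<iota>"
    and F: "\<And>k. k \<in> Arr J \<Longrightarrow> Dom J k \<in> Ob J \<and> Cod J k \<in> Ob J \<and>
      arr_map F k \<in> hom C (ob_map F (Dom J k)) (ob_map F (Cod J k))"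
    and hk: "h \<in> hom C L Z" "k \<in> hom C L Z" and eq: "\<And>j. j \<in> Ob J \<Longrightarrow> h \<cdot> \<iota> j = k \<cdot> \<iota> j"
  shows "h = k"
proof -
  have \<iota>: "\<And>j. j \<in> Ob J \<Longrightarrow> \<iota> j \<in> hom C (ob_map F j) L"
    "\<And>k. k \<in> Arr J \<Longrightarrow> \<iota> (Cod J k) \<cdot> arr_map F k = \<iota> (Dom J k)"
    using assms(1) by (auto simp: is_colimit_def is_cocone_def)
  have "is_cocone J C F Z (\<lambda>j. h \<cdot> \<iota> j)"
    unfolding is_cocone_def
  proof (intro conjI ballI)
    show "Z \<in> Ob C" using hk(1) cod_in_Ob by (auto simp: in_hom_iff)
    show "h \<cdot> \<iota> j \<in> hom C (ob_map F j) Z" if "j \<in> Ob J" for j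
      using \<iota>(1)[OF that] hk(1) by (rule Comp_hom)
    show "(h \<cdot> \<iota> (Cod J a)) \<cdot> arr_map F a = h \<cdot> \<iota> (Dom J a)" if "a \<in> Arr J" for a
      using Comp_assoc[of "arr_map F a" _ _ "\<iota> (Cod J a)" L h Z] F[OF that] \<iota> that hk(1) by metis
  qed
  then have "\<exists>!h'. h' \<in> hom C L Z \<and> (\<forall>j\<in>Ob J. h' \<cdot> \<iota> j = h \<cdot> \<iota> j)"
    using assms(1) by (simp add: is_colimit_def)
  then show ?thesis using hk eq by metis
qed

end

context symmetric_monoidal_category
begin

lemma functor_tensor_left: "A \<in> Ob C \<Longrightarrow> is_functor C C (tensor_left C A)"
  by unfold_locales (auto simp: tensor_left_def in_hom_iff)

lemma functor_tensor_right: "A \<in> Ob C \<Longrightarrow> is_functor C C (tensor_right C A)"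
  by unfold_locales (auto simp: tensor_right_def in_hom_iff)

lemma power_cocone:
  assumes "is_functor C C G" "X \<in> Ob C" "Z \<in> Ob C"
    and \<kappa>: "\<And>n. \<kappa> n \<in> hom C (ob_map G (tensor_power C X n)) Z"
    and swap: "\<And>i n. Suc i < n \<Longrightarrow> \<kappa> n \<cdot> arr_map G (swap_factors C X i n) = \<kappa> n"
  shows "is_cocone perm_category C (functor_comp G (power_functor C X)) Z \<kappa>"
proof -
  interpret G: is_functor C C G by fact
  have "\<kappa> n \<cdot> arr_map G g = \<kappa> n" if "g \<in> swap_composites X n" for n g
    using that
  proof induction
    case id_swap_composite
    then show ?case using \<kappa>[of n] assms(2) by (simp add: G.arr_map_Id in_hom_iff)
  next
    case (swap_swap_composite g i)
    have hom: "g \<in> hom C (tensor_power C X n) (tensor_power C X n)"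
      "swap_factors C X i n \<in> hom C (tensor_power C X n) (tensor_power C X n)"
      using swap_composite_typing[OF swap_swap_composite.hyps(1) assms(2)]
        swap_factors_typing[OF assms(2) swap_swap_composite.hyps(2)] by (simp_all add: in_hom_iff)
    then show ?case
      using G.arr_map_hom[OF hom(1)] G.arr_map_hom[OF hom(2)] \<kappa>[of n] swap_swap_composite.IH
        reassoc[OF swap[OF swap_swap_composite.hyps(2)]]
      by (simp add: G.arr_map_Comp[OF hom] in_hom_iff)
  qed
  then show ?thesis
    using assms(2,3) \<kappa> permute_factors_swap_composite
    by (auto simp: is_cocone_def perm_category_def functor_comp_def power_functor_def)
qed

lemma power_functor_typing:
  assumes "X \<in> Ob C" "k \<in> Arr perm_category"
  shows "arr_map (power_functor C X) k \<in>
    hom C (ob_map (power_functor C X) (Dom perm_category k)) (ob_map (power_functor C X) (Cod perm_category k))"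
  using swap_composite_typing[OF permute_factors_swap_composite, OF assms(1,1)]
  by (auto simp: perm_category_def power_functor_def split: prod.splits)

end

section \<open>Modules and categories of actions\<close>

context symmetric_monoidal_category
begin

definition right_module where
  "right_module M u m A \<rho> \<longleftrightarrow> A \<in> Ob C \<and> \<rho> \<in> hom C (A \<odot> M) A \<and>
     \<rho> \<cdot> (\<rho> \<otimes> Id C M) = \<rho> \<cdot> (Id C A \<otimes> m) \<cdot> asc A M M \<and> \<rho> \<cdot> (Id C A \<otimes> u) = run A"

lemma right_moduleD:
  assumes "right_module M u m A \<rho>"
  shows "A \<in> Ob C" "\<rho> \<in> Arr C" "Dom C \<rho> = A \<odot> M" "Cod C \<rho> = A"
    "\<rho> \<cdot> (\<rho> \<otimes> Id C M) = \<rho> \<cdot> (Id C A \<otimes> m) \<cdot> asc A M M" "\<rho> \<cdot> (Id C A \<otimes> u) = run A"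
  using assms by (auto simp: right_module_def in_hom_iff)

lemma commutative_monoidD:
  assumes "commutative_monoid_object C M u m"
  shows "M \<in> Ob C" "u \<in> Arr C" "Dom C u = \<one>" "Cod C u = M" "m \<in> Arr C" "Dom C m = M \<odot> M" "Cod C m = M"
    "m \<cdot> (m \<otimes> Id C M) = m \<cdot> (Id C M \<otimes> m) \<cdot> asc M M M"
    "m \<cdot> (u \<otimes> Id C M) = lun M" "m \<cdot> (Id C M \<otimes> u) = run M" "m \<cdot> sym M M = m"
  using assms by (auto simp: commutative_monoid_object_def in_hom_iff)

lemma right_module_self:
  "commutative_monoid_object C M u m \<Longrightarrow> right_module M u m M m"
  by (simp add: commutative_monoid_object_def right_module_def)

text \<open>Acting twice through \<open>g\<close> is acting once through \<open>m \<cdot> (g \<otimes> g)\<close>. If \<open>m\<close> is commutative, this arrow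
absorbs the symmetry, which makes the restricted action commute.\<close>
lemma restricted_action_twice:
  assumes "commutative_monoid_object C M u m" "right_module M u m A \<rho>" "g \<in> hom C X M" "X \<in> Ob C"
  shows "(\<rho> \<cdot> (Id C A \<otimes> g)) \<cdot> ((\<rho> \<cdot> (Id C A \<otimes> g)) \<otimes> Id C X)
    = \<rho> \<cdot> (Id C A \<otimes> (m \<cdot> (g \<otimes> g))) \<cdot> asc A X X"
proof -
  note [simp] = commutative_monoidD(1-7)[OF assms(1)] right_moduleD(1-4)[OF assms(2)] assms(4)
  have [simp]: "g \<in> Arr C" "Dom C g = X" "Cod C g = M"
    using assms(3) by (auto simp: in_hom_iff)
  have "(\<rho> \<cdot> (Id C A \<otimes> g)) \<cdot> ((\<rho> \<cdot> (Id C A \<otimes> g)) \<otimes> Id C X)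
    = \<rho> \<cdot> (\<rho> \<otimes> Id C M) \<cdot> (Id C (A \<odot> M) \<otimes> g) \<cdot> ((Id C A \<otimes> g) \<otimes> Id C X)"
    by (simp add: reassoc[OF whisker_exchange])
  also have "\<dots> = (\<rho> \<cdot> (\<rho> \<otimes> Id C M)) \<cdot> ((Id C A \<otimes> g) \<otimes> g)"
    by (simp add: interchange)
  also have "\<dots> = \<rho> \<cdot> (Id C A \<otimes> (m \<cdot> (g \<otimes> g))) \<cdot> asc A X X"
    unfolding right_moduleD(5)[OF assms(2)] by (simp add: asc_natural)
  finally show ?thesis .
qed

lemma module_map_restrict:
  assumes "right_module M u m A \<rho>" "right_module M u m B \<rho>'" "g \<in> hom C X M" "X \<in> Ob C" "M \<in> Ob C"
    and "f \<in> hom C A B" "f \<cdot> \<rho> = \<rho>' \<cdot> (f \<otimes> Id C M)"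
  shows "f \<cdot> \<rho> \<cdot> (Id C A \<otimes> g) = (\<rho>' \<cdot> (Id C B \<otimes> g)) \<cdot> (f \<otimes> Id C X)"
proof -
  note [simp] = right_moduleD(1-4)[OF assms(1)] right_moduleD(1-4)[OF assms(2)] assms(4,5)
  have [simp]: "g \<in> Arr C" "Dom C g = X" "Cod C g = M" "f \<in> Arr C" "Dom C f = A" "Cod C f = B"
    using assms(3,6) by (auto simp: in_hom_iff)
  show ?thesis
    by (simp add: reassoc[OF assms(7)] whisker_exchange)
qed

text \<open>This separates the source and target, which an arrow carries with it, from its underlying arrow of \<open>C\<close>.\<close>
lemma action_category_hom_iff:
  "\<phi> \<in> hom (action_category C X P) a b \<longleftrightarrow> a \<in> P \<and> b \<in> P \<and>
     (\<exists>f. \<phi> = (a, f, b) \<and> f \<in> hom C (fst a) (fst b) \<and> f \<cdot> snd a = snd b \<cdot> (f \<otimes> Id C X))"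
  unfolding hom_def[of "action_category C X P" a b] by (cases a, cases b) (auto simp: action_category_def)

lemma category_action_category:
  assumes "X \<in> Ob C" "\<And>A \<alpha>. (A, \<alpha>) \<in> P \<Longrightarrow> A \<in> Ob C \<and> \<alpha> \<in> hom C (A \<odot> X) A"
  shows "category (action_category C X P)"
proof
  have P: "fst a \<in> Ob C" "snd a \<in> Arr C" "Dom C (snd a) = fst a \<odot> X" "Cod C (snd a) = fst a"
    if "a \<in> P" for a
    using assms(2)[of "fst a" "snd a"] that by (auto simp: in_hom_iff)
  note [simp] = assms(1) P
  fix a b c d f g h
  let ?D = "action_category C X P"
  have D: "Id ?D a = (a, Id C (fst a), a)" "(a', g', c) \<cdot>\<^bsub>?D\<^esub> (a, f', b') = (a, g' \<cdot> f', c)"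
    for a a' b' c f' g'
    by (simp_all add: action_category_def split: prod.split)
  show "f \<in> Arr ?D \<Longrightarrow> Dom ?D f \<in> Ob ?D" "f \<in> Arr ?D \<Longrightarrow> Cod ?D f \<in> Ob ?D"
    by (auto simp: action_category_def)
  show "a \<in> Ob ?D \<Longrightarrow> Id ?D a \<in> hom ?D a a"
    unfolding action_category_hom_iff D by (auto simp: action_category_def in_hom_iff)
  show "f \<in> hom ?D a b \<Longrightarrow> f \<cdot>\<^bsub>?D\<^esub> Id ?D a = f" "f \<in> hom ?D a b \<Longrightarrow> Id ?D b \<cdot>\<^bsub>?D\<^esub> f = f"
    by (auto simp: action_category_hom_iff D in_hom_iff)
  show "g \<cdot>\<^bsub>?D\<^esub> f \<in> hom ?D a c" if fg: "f \<in> hom ?D a b" "g \<in> hom ?D b c"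
  proof -
    obtain f' g' where *: "f = (a, f', b)" "g = (b, g', c)" "a \<in> P" "b \<in> P" "c \<in> P"
      "f' \<in> hom C (fst a) (fst b)" "g' \<in> hom C (fst b) (fst c)"
      "f' \<cdot> snd a = snd b \<cdot> (f' \<otimes> Id C X)" "g' \<cdot> snd b = snd c \<cdot> (g' \<otimes> Id C X)"
      using fg unfolding action_category_hom_iff by blast
    then have "(g' \<cdot> f') \<cdot> snd a = snd c \<cdot> ((g' \<cdot> f') \<otimes> Id C X)"
      by (simp add: reassoc[OF *(9)] in_hom_iff)
    with * show ?thesis by (simp add: action_category_hom_iff D in_hom_iff)
  qed
  show "(h \<cdot>\<^bsub>?D\<^esub> g) \<cdot>\<^bsub>?D\<^esub> f = h \<cdot>\<^bsub>?D\<^esub> (g \<cdot>\<^bsub>?D\<^esub> f)"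
    if "f \<in> hom ?D a b" "g \<in> hom ?D b c" "h \<in> hom ?D c d"
    using that by (auto simp: action_category_hom_iff D in_hom_iff)
qed

end

section \<open>The symmetric algebra as a colimit\<close>

locale symmetric_algebra = symmetric_monoidal_category C
  for C :: "('o, 'a, 'z) sym_mon_data_scheme" (structure) +
  fixes X S :: 'o and \<iota> :: "nat \<Rightarrow> 'a"
  assumes X_Ob [simp]: "X \<in> Ob C"
    and colimit: "is_colimit perm_category C (power_functor C X) S \<iota>"
    and preserved_left: "A \<in> Ob C \<Longrightarrow>
      preserves_colimit perm_category C (tensor_left C A) (power_functor C X) S \<iota>"
    and preserved_right: "A \<in> Ob C \<Longrightarrow>
      preserves_colimit perm_category C (tensor_right C A) (power_functor C X) S \<iota>"
begin

abbreviation power where "power \<equiv> tensor_power C X"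

lemma inclusion_typing [simp]:
  "S \<in> Ob C" "\<iota> n \<in> Arr C" "Dom C (\<iota> n) = power n" "Cod C (\<iota> n) = S"
  using colimit
  by (auto simp: is_colimit_def is_cocone_def perm_category_def power_functor_def in_hom_iff)

lemma inclusion_swap:
  assumes "Suc i < n"
  shows "\<iota> n \<cdot> swap_factors C X i n = \<iota> n"
proof -
  have "(n, Transposition.transpose i (Suc i)) \<in> Arr perm_category"
    using assms by (simp add: perm_category_def permutes_swap_id)
  moreover have "\<forall>k\<in>Arr perm_category. \<iota> (Cod perm_category k) \<cdot> arr_map (power_functor C X) k
      = \<iota> (Dom perm_category k)"
    using colimit by (simp add: is_colimit_def is_cocone_def)
  ultimately show ?thesis
    using assms permute_factors_transpose[of X i n]
    by (force simp: perm_category_def power_functor_def)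
qed

lemma inclusions_jointly_epic:
  assumes "h \<in> hom C S Z" "k \<in> hom C S Z" "\<And>n. h \<cdot> \<iota> n = k \<cdot> \<iota> n"
  shows "h = k"
  using colimit_jointly_epic[OF colimit _ assms(1,2)] power_functor_typing[OF X_Ob] assms(3)
  by (auto simp: perm_category_def)

lemma preserved_jointly_epic:
  assumes G: "is_functor C C G" "preserves_colimit perm_category C G (power_functor C X) S \<iota>"
    and "h \<in> hom C (ob_map G S) Z" "k \<in> hom C (ob_map G S) Z"
    and "\<And>n. h \<cdot> arr_map G (\<iota> n) = k \<cdot> arr_map G (\<iota> n)"
  shows "h = k"
proof (rule colimit_jointly_epic[OF G(2)[unfolded preserves_colimit_def] _ assms(3,4)])
  show "Dom perm_category a \<in> Ob perm_category \<and> Cod perm_category a \<in> Ob perm_category \<and>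
    arr_map (functor_comp G (power_functor C X)) a
      \<in> hom C (ob_map (functor_comp G (power_functor C X)) (Dom perm_category a))
          (ob_map (functor_comp G (power_functor C X)) (Cod perm_category a))"
    if "a \<in> Arr perm_category" for a
    using is_functor.arr_map_hom[OF G(1) power_functor_typing[OF X_Ob that]]
    by (simp add: functor_comp_def) (simp add: perm_category_def)
qed (use assms(5) in simp)

lemma left_jointly_epic:
  assumes "A \<in> Ob C" "h \<in> hom C (A \<odot> S) Z" "k \<in> hom C (A \<odot> S) Z"
    and "\<And>n. h \<cdot> (Id C A \<otimes> \<iota> n) = k \<cdot> (Id C A \<otimes> \<iota> n)"
  shows "h = k"
  using preserved_jointly_epic[OF functor_tensor_left preserved_left, of A h Z k] assms
  by (simp add: tensor_left_def)

lemma right_jointly_epic: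
  assumes "A \<in> Ob C" "h \<in> hom C (S \<odot> A) Z" "k \<in> hom C (S \<odot> A) Z"
    and "\<And>n. h \<cdot> (\<iota> n \<otimes> Id C A) = k \<cdot> (\<iota> n \<otimes> Id C A)"
  shows "h = k"
  using preserved_jointly_epic[OF functor_tensor_right preserved_right, of A h Z k] assms
  by (simp add: tensor_right_def)

text \<open>By \<open>power_cocone\<close>, invariance under adjacent exchanges is all that the universal property of a
preserved colimit asks of a family of arrows.\<close>
lemma preserved_factorization:
  assumes G: "is_functor C C G" "preserves_colimit perm_category C G (power_functor C X) S \<iota>"
    and "Z \<in> Ob C" "\<And>n. \<kappa> n \<in> hom C (ob_map G (power n)) Z"
    and "\<And>i n. Suc i < n \<Longrightarrow> \<kappa> n \<cdot> arr_map G (swap_factors C X i n) = \<kappa> n"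
  shows "\<exists>h. h \<in> hom C (ob_map G S) Z \<and> (\<forall>n. h \<cdot> arr_map G (\<iota> n) = \<kappa> n)"
proof -
  have "\<exists>!h. h \<in> hom C (ob_map G S) Z \<and> (\<forall>n \<in> Ob perm_category. h \<cdot> arr_map G (\<iota> n) = \<kappa> n)"
    using G(2) power_cocone[OF G(1) X_Ob assms(3-5)]
    by (simp add: preserves_colimit_def is_colimit_def)
  then show ?thesis
    by (auto simp: perm_category_def)
qed

lemma left_factorization:
  assumes "A \<in> Ob C" "Z \<in> Ob C" "\<And>n. \<kappa> n \<in> hom C (A \<odot> power n) Z"
    and "\<And>i n. Suc i < n \<Longrightarrow> \<kappa> n \<cdot> (Id C A \<otimes> swap_factors C X i n) = \<kappa> n"
  shows "\<exists>h. h \<in> hom C (A \<odot> S) Z \<and> (\<forall>n. h \<cdot> (Id C A \<otimes> \<iota> n) = \<kappa> n)"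
  using preserved_factorization[OF functor_tensor_left preserved_left, of A Z \<kappa>] assms
  by (simp add: tensor_left_def)

lemma right_factorization:
  assumes "A \<in> Ob C" "Z \<in> Ob C" "\<And>n. \<kappa> n \<in> hom C (power n \<odot> A) Z"
    and "\<And>i n. Suc i < n \<Longrightarrow> \<kappa> n \<cdot> (swap_factors C X i n \<otimes> Id C A) = \<kappa> n"
  shows "\<exists>h. h \<in> hom C (S \<odot> A) Z \<and> (\<forall>n. h \<cdot> (\<iota> n \<otimes> Id C A) = \<kappa> n)"
  using preserved_factorization[OF functor_tensor_right preserved_right, of A Z \<kappa>] assms
  by (simp add: tensor_right_def)


section \<open>The free commuting action\<close>

definition commuting_action where
  "commuting_action A \<alpha> \<longleftrightarrow> A \<in> Ob C \<and> \<alpha> \<in> hom C (A \<odot> X) A \<and>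
     \<alpha> \<cdot> (\<alpha> \<otimes> Id C X) \<cdot> exchange A X X = \<alpha> \<cdot> (\<alpha> \<otimes> Id C X)"

lemma commuting_actionD:
  assumes "commuting_action A \<alpha>"
  shows "A \<in> Ob C" "\<alpha> \<in> Arr C" "Dom C \<alpha> = A \<odot> X" "Cod C \<alpha> = A"
    "\<alpha> \<cdot> (\<alpha> \<otimes> Id C X) \<cdot> exchange A X X = \<alpha> \<cdot> (\<alpha> \<otimes> Id C X)"
  using assms by (auto simp: commuting_action_def in_hom_iff)

text \<open>The arrow \<open>A \<odot> X\<^sup>n \<rightarrow> A\<close> which applies \<open>\<alpha>\<close> once for each factor, starting with the leftmost
one.\<close>
primrec iterate where
  "iterate A \<alpha> 0 = run A"
| "iterate A \<alpha> (Suc n) = \<alpha> \<cdot> (iterate A \<alpha> n \<otimes> Id C X) \<cdot> asc_inv A (power n) X"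

lemma iterate_typing:
  assumes "A \<in> Ob C" "\<alpha> \<in> hom C (A \<odot> X) A"
  shows "iterate A \<alpha> n \<in> hom C (A \<odot> power n) A"
  using assms by (induction n) (simp_all add: in_hom_iff)

text \<open>An exchange of the last two factors is carried by \<open>tensor_exchange_inv\<close> and naturality to an
exchange of the last two arguments of \<open>\<alpha> \<cdot> (\<alpha> \<otimes> Id)\<close>, where the commutation axiom absorbs it. An earlier
exchange is absorbed by the induction hypothesis.\<close>
lemma iterate_swap:
  assumes "commuting_action A \<alpha>" "Suc i < n"
  shows "iterate A \<alpha> n \<cdot> (Id C A \<otimes> swap_factors C X i n) = iterate A \<alpha> n"
  using assms(2)
proof (induction n)
  case (Suc n)
  note \<alpha> = commuting_actionD[OF assms(1)]
  have iter: "iterate A \<alpha> k \<in> Arr C" "Dom C (iterate A \<alpha> k) = A \<odot> power k" "Cod C (iterate A \<alpha> k) = A" for k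
    using iterate_typing[of A \<alpha> k] \<alpha> by (auto simp: in_hom_iff)
  show ?case
  proof (cases "Suc i = n")
    case True
    let ?h = "iterate A \<alpha> i" and ?P = "power i"
    have "iterate A \<alpha> (Suc n) \<cdot> (Id C A \<otimes> swap_factors C X i (Suc n))
      = \<alpha> \<cdot> (\<alpha> \<otimes> Id C X) \<cdot> ((?h \<otimes> Id C X) \<otimes> Id C X) \<cdot> (asc_inv A ?P X \<otimes> Id C X) \<cdot>
          asc_inv A (?P \<odot> X) X \<cdot> (Id C A \<otimes> exchange ?P X X)"
      unfolding True[symmetric] swap_factors_last using \<alpha> iter by simp
    also have "\<dots> = \<alpha> \<cdot> (\<alpha> \<otimes> Id C X) \<cdot> ((?h \<otimes> Id C X) \<otimes> Id C X) \<cdot> exchange (A \<odot> ?P) X X \<cdot>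
        (asc_inv A ?P X \<otimes> Id C X) \<cdot> asc_inv A (?P \<odot> X) X"
      using \<alpha> by (simp add: tensor_exchange_inv)
    also have "\<dots> = \<alpha> \<cdot> (\<alpha> \<otimes> Id C X) \<cdot> exchange A X X \<cdot> ((?h \<otimes> Id C X) \<otimes> Id C X) \<cdot>
        (asc_inv A ?P X \<otimes> Id C X) \<cdot> asc_inv A (?P \<odot> X) X"
      using \<alpha> iter by (simp add: reassoc[OF exchange_natural])
    also have "\<dots> = (\<alpha> \<cdot> (\<alpha> \<otimes> Id C X) \<cdot> exchange A X X) \<cdot> ((?h \<otimes> Id C X) \<otimes> Id C X) \<cdot>
        (asc_inv A ?P X \<otimes> Id C X) \<cdot> asc_inv A (?P \<odot> X) X"
      using \<alpha>(1-4) iter by simp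
    also have "\<dots> = iterate A \<alpha> (Suc n)"
      unfolding True[symmetric] \<alpha>(5) using \<alpha>(1-4) iter by simp
    finally show ?thesis .
  next
    case False
    then have i: "Suc i < n" using Suc.prems by simp
    have "iterate A \<alpha> (Suc n) \<cdot> (Id C A \<otimes> swap_factors C X i (Suc n))
      = \<alpha> \<cdot> (iterate A \<alpha> n \<otimes> Id C X) \<cdot> asc_inv A (power n) X \<cdot> (Id C A \<otimes> (swap_factors C X i n \<otimes> Id C X))"
      using False i \<alpha> iter by simp
    also have "\<dots> = \<alpha> \<cdot> ((iterate A \<alpha> n \<cdot> (Id C A \<otimes> swap_factors C X i n)) \<otimes> Id C X) \<cdot> asc_inv A (power n) X"
      using i \<alpha> iter asc_inv_natural[of "Id C A" "swap_factors C X i n" "Id C X"] by simp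
    also have "\<dots> = iterate A \<alpha> (Suc n)"
      using i Suc.IH by simp
    finally show ?thesis .
  qed
qed simp

text \<open>Since the tensor product with \<open>X\<close> on the right preserves the colimit, \<open>S \<odot> X\<close> is the colimit of
the \<open>X\<^sup>n\<^sup>+\<^sup>1\<close>, and so \<open>S\<close> carries an action of \<open>X\<close> given by \<open>\<iota> (n + 1)\<close> on
\<open>X\<^sup>n \<odot> X\<close>: it appends one factor.\<close>
definition act where
  "act = (SOME h. h \<in> hom C (S \<odot> X) S \<and> (\<forall>n. h \<cdot> (\<iota> n \<otimes> Id C X) = \<iota> (Suc n)))"

lemma act_spec: "act \<in> hom C (S \<odot> X) S \<and> (\<forall>n. act \<cdot> (\<iota> n \<otimes> Id C X) = \<iota> (Suc n))"
  unfolding act_def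
proof (rule someI_ex, rule right_factorization)
  show "\<iota> (Suc n) \<cdot> (swap_factors C X i n \<otimes> Id C X) = \<iota> (Suc n)" if "Suc i < n" for i n
    using inclusion_swap[of i "Suc n"] that by simp
qed (simp_all add: in_hom_iff)

lemma act_typing [simp]: "act \<in> Arr C" "Dom C act = S \<odot> X" "Cod C act = S"
  using act_spec by (auto simp: in_hom_iff)

lemma act_inclusion: "act \<cdot> (\<iota> n \<otimes> Id C X) = \<iota> (Suc n)"
  using act_spec by simp

text \<open>On \<open>(X\<^sup>n \<odot> X) \<odot> X\<close>, acting twice is the inclusion \<open>\<iota> (n + 2)\<close>, which absorbs the exchange of the last two
factors. These inclusions test equality because \<open>S \<odot> (X \<odot> X)\<close> is again a colimit; the associator
transports this to \<open>(S \<odot> X) \<odot> X\<close>.\<close>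
lemma commuting_act: "commuting_action S act"
proof -
  have eq: "act \<cdot> (act \<otimes> Id C X) \<cdot> exchange S X X \<cdot> asc_inv S X X = act \<cdot> (act \<otimes> Id C X) \<cdot> asc_inv S X X"
  proof (rule right_jointly_epic)
    fix n
    let ?e = "exchange (power n) X X" and ?a = "asc_inv (power n) X X"
    have "act \<cdot> (act \<otimes> Id C X) \<cdot> ((\<iota> n \<otimes> Id C X) \<otimes> Id C X) = act \<cdot> ((act \<cdot> (\<iota> n \<otimes> Id C X)) \<otimes> Id C X)"
      by simp
    then have inc: "act \<cdot> (act \<otimes> Id C X) \<cdot> ((\<iota> n \<otimes> Id C X) \<otimes> Id C X) = \<iota> (Suc (Suc n))"
      by (simp only: act_inclusion)
    have asc: "asc_inv S X X \<cdot> (\<iota> n \<otimes> Id C (X \<odot> X)) = ((\<iota> n \<otimes> Id C X) \<otimes> Id C X) \<cdot> ?a"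
      using asc_inv_natural[of "\<iota> n" "Id C X" "Id C X"] by simp
    have "(act \<cdot> (act \<otimes> Id C X) \<cdot> exchange S X X \<cdot> asc_inv S X X) \<cdot> (\<iota> n \<otimes> Id C (X \<odot> X))
      = act \<cdot> (act \<otimes> Id C X) \<cdot> exchange S X X \<cdot> ((\<iota> n \<otimes> Id C X) \<otimes> Id C X) \<cdot> ?a"
      by (simp add: asc)
    also have "\<dots> = (act \<cdot> (act \<otimes> Id C X) \<cdot> ((\<iota> n \<otimes> Id C X) \<otimes> Id C X)) \<cdot> ?e \<cdot> ?a"
      by (simp add: reassoc[OF exchange_natural])
    also have "\<dots> = \<iota> (Suc (Suc n)) \<cdot> ?a"
      unfolding inc
      using reassoc[OF inclusion_swap[of n "Suc (Suc n)", unfolded swap_factors_last], of ?a] by simp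
    also have "\<dots> = (act \<cdot> (act \<otimes> Id C X) \<cdot> ((\<iota> n \<otimes> Id C X) \<otimes> Id C X)) \<cdot> ?a"
      by (simp only: inc)
    also have "\<dots> = (act \<cdot> (act \<otimes> Id C X) \<cdot> asc_inv S X X) \<cdot> (\<iota> n \<otimes> Id C (X \<odot> X))"
      by (simp add: asc)
    finally show "(act \<cdot> (act \<otimes> Id C X) \<cdot> exchange S X X \<cdot> asc_inv S X X) \<cdot> (\<iota> n \<otimes> Id C (X \<odot> X)) = \<dots>" .
  qed (simp_all add: in_hom_iff)
  have "act \<cdot> (act \<otimes> Id C X) \<cdot> exchange S X X = act \<cdot> (act \<otimes> Id C X)"
    by (rule iso_cancel_right[OF inverse_arrows_sym[OF iso_asc[of S X X]]]) (use eq in simp_all)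
  then show ?thesis
    by (simp add: commuting_action_def in_hom_iff)
qed

text \<open>The candidate for the \<open>S\<close>-module structure of a commuting action, glued from its iterates.\<close>
definition extension where
  "extension A \<alpha> = (SOME h. h \<in> hom C (A \<odot> S) A \<and> (\<forall>n. h \<cdot> (Id C A \<otimes> \<iota> n) = iterate A \<alpha> n))"

lemma extension_spec:
  assumes "commuting_action A \<alpha>"
  shows "extension A \<alpha> \<in> hom C (A \<odot> S) A \<and> (\<forall>n. extension A \<alpha> \<cdot> (Id C A \<otimes> \<iota> n) = iterate A \<alpha> n)"
  unfolding extension_def
  by (rule someI_ex, rule left_factorization)
    (use assms in \<open>auto simp: iterate_swap iterate_typing commuting_action_def\<close>)

lemma extension_typing:
  assumes "commuting_action A \<alpha>"
  shows "extension A \<alpha> \<in> Arr C" "Dom C (extension A \<alpha>) = A \<odot> S" "Cod C (extension A \<alpha>) = A"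
  using extension_spec[OF assms] by (auto simp: in_hom_iff)

lemma extension_inclusion:
  "commuting_action A \<alpha> \<Longrightarrow> extension A \<alpha> \<cdot> (Id C A \<otimes> \<iota> n) = iterate A \<alpha> n"
  using extension_spec by blast

lemma extension_unit: "commuting_action A \<alpha> \<Longrightarrow> extension A \<alpha> \<cdot> (Id C A \<otimes> \<iota> 0) = run A"
  by (simp add: extension_inclusion)

text \<open>Equivariance of \<open>h : B \<odot> S \<rightarrow> A\<close> for the action of \<open>X\<close> on \<open>B \<odot> S\<close> through the right-hand factor.\<close>
definition equivariant where
  "equivariant B A \<alpha> h \<longleftrightarrow> h \<in> hom C (B \<odot> S) A \<and>
     h \<cdot> (Id C B \<otimes> act) \<cdot> asc B S X = \<alpha> \<cdot> (h \<otimes> Id C X)"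

lemma equivariantD:
  assumes "equivariant B A \<alpha> h"
  shows "h \<in> Arr C" "Dom C h = B \<odot> S" "Cod C h = A"
    "h \<cdot> (Id C B \<otimes> act) \<cdot> asc B S X = \<alpha> \<cdot> (h \<otimes> Id C X)"
  using assms by (auto simp: equivariant_def in_hom_iff)

lemma equivariant_inclusion_Suc:
  assumes "equivariant B A \<alpha> h" "B \<in> Ob C" "\<alpha> \<in> hom C (A \<odot> X) A"
  shows "h \<cdot> (Id C B \<otimes> \<iota> (Suc n)) = \<alpha> \<cdot> ((h \<cdot> (Id C B \<otimes> \<iota> n)) \<otimes> Id C X) \<cdot> asc_inv B (power n) X"
proof -
  note h = equivariantD[OF assms(1)]
  have \<alpha>: "\<alpha> \<in> Arr C" "Dom C \<alpha> = A \<odot> X" "Cod C \<alpha> = A" "A \<in> Ob C"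
    using assms(3) cod_in_Ob[of \<alpha>] by (auto simp: in_hom_iff)
  have "h \<cdot> (Id C B \<otimes> \<iota> (Suc n))
    = h \<cdot> (Id C B \<otimes> act) \<cdot> (Id C B \<otimes> (\<iota> n \<otimes> Id C X)) \<cdot> asc B (power n) X \<cdot> asc_inv B (power n) X"
    using h(1-3) assms(2) by (simp flip: act_inclusion)
  also have "\<dots> = h \<cdot> (Id C B \<otimes> act) \<cdot> asc B S X \<cdot> ((Id C B \<otimes> \<iota> n) \<otimes> Id C X) \<cdot> asc_inv B (power n) X"
    using h(1-3) assms(2) by (simp add: reassoc[OF asc_natural])
  also have "\<dots> = (h \<cdot> (Id C B \<otimes> act) \<cdot> asc B S X) \<cdot> ((Id C B \<otimes> \<iota> n) \<otimes> Id C X) \<cdot> asc_inv B (power n) X"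
    using h(1-3) assms(2) by simp
  also have "\<dots> = \<alpha> \<cdot> ((h \<cdot> (Id C B \<otimes> \<iota> n)) \<otimes> Id C X) \<cdot> asc_inv B (power n) X"
    unfolding h(4) using h(1-3) \<alpha> assms(2) by simp
  finally show ?thesis .
qed

text \<open>Uniqueness in the statement that \<open>B \<odot> S\<close> is the free commuting action on \<open>B\<close>: equivariance
determines \<open>h\<close> on \<open>B \<odot> X\<^sup>n\<^sup>+\<^sup>1\<close> from its values on \<open>B \<odot> X\<^sup>n\<close>. It is the main tool for the
identities below.\<close>
lemma equivariant_eqI:
  assumes "equivariant B A \<alpha> h" "equivariant B A \<alpha> k" "B \<in> Ob C" "\<alpha> \<in> hom C (A \<odot> X) A"
    and "h \<cdot> (Id C B \<otimes> \<iota> 0) = k \<cdot> (Id C B \<otimes> \<iota> 0)"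
  shows "h = k"
proof (rule left_jointly_epic[OF assms(3)])
  show "h \<in> hom C (B \<odot> S) A" "k \<in> hom C (B \<odot> S) A"
    using assms by (simp_all add: equivariant_def)
  show "h \<cdot> (Id C B \<otimes> \<iota> n) = k \<cdot> (Id C B \<otimes> \<iota> n)" for n
  proof (induction n)
    case (Suc n)
    then show ?case
      by (simp only: equivariant_inclusion_Suc[OF assms(1,3,4)] equivariant_inclusion_Suc[OF assms(2,3,4)])
  qed (rule assms(5))
qed

text \<open>The exchange isomorphism turns \<open>(A \<odot> S) \<odot> B\<close> into \<open>(A \<odot> B) \<odot> S\<close>, where a single left tensor product
preserves the colimit.\<close>
lemma left_tensor_jointly_epic:
  assumes "A \<in> Ob C" "B \<in> Ob C" "f \<in> hom C ((A \<odot> S) \<odot> B) Z" "g \<in> hom C ((A \<odot> S) \<odot> B) Z"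
    and eq: "\<And>n. f \<cdot> ((Id C A \<otimes> \<iota> n) \<otimes> Id C B) = g \<cdot> ((Id C A \<otimes> \<iota> n) \<otimes> Id C B)"
  shows "f = g"
proof -
  have fg: "f \<in> Arr C" "Dom C f = (A \<odot> S) \<odot> B" "g \<in> Arr C" "Dom C g = (A \<odot> S) \<odot> B" "Cod C f = Z" "Cod C g = Z"
    using assms(3,4) by (auto simp: in_hom_iff)
  have nat: "exchange A B S \<cdot> (Id C (A \<odot> B) \<otimes> \<iota> n) = ((Id C A \<otimes> \<iota> n) \<otimes> Id C B) \<cdot> exchange A B (power n)" for n
    using assms(1,2) exchange_natural[of "Id C A" "Id C B" "\<iota> n"] by simp
  have "f \<cdot> exchange A B S = g \<cdot> exchange A B S"
    by (rule left_jointly_epic[of "A \<odot> B" _ Z])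
      (use assms(1,2) fg in \<open>simp_all add: in_hom_iff nat reassoc[OF eq]\<close>)
  then have "(f \<cdot> exchange A B S) \<cdot> exchange A S B = (g \<cdot> exchange A B S) \<cdot> exchange A S B"
    by simp
  then show ?thesis
    using assms(1,2) fg by (simp add: exchange_involutive)
qed

text \<open>Restricted to \<open>(A \<odot> X\<^sup>n) \<odot> X\<close>, this is the recursion that defines \<open>iterate\<close>.\<close>
lemma extension_equivariant:
  assumes "commuting_action A \<alpha>"
  shows "equivariant A A \<alpha> (extension A \<alpha>)"
proof -
  note \<alpha> = commuting_actionD[OF assms]
  note [simp] = extension_typing[OF assms] \<alpha>(1-4)
  let ?h = "extension A \<alpha>"
  have "?h \<cdot> (Id C A \<otimes> act) \<cdot> asc A S X = \<alpha> \<cdot> (?h \<otimes> Id C X)"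
  proof (rule left_tensor_jointly_epic)
    fix n
    have "(?h \<cdot> (Id C A \<otimes> act) \<cdot> asc A S X) \<cdot> ((Id C A \<otimes> \<iota> n) \<otimes> Id C X)
      = ?h \<cdot> (Id C A \<otimes> (act \<cdot> (\<iota> n \<otimes> Id C X))) \<cdot> asc A (power n) X"
      by (simp add: asc_natural)
    also have "\<dots> = iterate A \<alpha> (Suc n) \<cdot> asc A (power n) X"
      unfolding act_inclusion
      using reassoc[OF extension_inclusion[OF assms, of "Suc n"], of "asc A (power n) X"] by simp
    also have "\<dots> = \<alpha> \<cdot> ((?h \<cdot> (Id C A \<otimes> \<iota> n)) \<otimes> Id C X)"
      using iterate_typing[of A \<alpha> n]
      by (simp only: extension_inclusion[OF assms]) (simp add: in_hom_iff)
    finally show "(?h \<cdot> (Id C A \<otimes> act) \<cdot> asc A S X) \<cdot> ((Id C A \<otimes> \<iota> n) \<otimes> Id C X)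
      = (\<alpha> \<cdot> (?h \<otimes> Id C X)) \<cdot> ((Id C A \<otimes> \<iota> n) \<otimes> Id C X)"
      by simp
  qed (simp_all add: in_hom_iff)
  then show ?thesis by (simp add: equivariant_def in_hom_iff)
qed


lemma equivariant_comp_source:
  assumes "equivariant B A \<alpha> h" "f \<in> hom C B' B" "B \<in> Ob C" "B' \<in> Ob C" "\<alpha> \<in> hom C (A \<odot> X) A"
  shows "equivariant B' A \<alpha> (h \<cdot> (f \<otimes> Id C S))"
proof -
  have [simp]: "f \<in> Arr C" "Dom C f = B'" "Cod C f = B" "\<alpha> \<in> Arr C" "Dom C \<alpha> = A \<odot> X" "Cod C \<alpha> = A"
    using assms(2,5) by (auto simp: in_hom_iff)
  note [simp] = equivariantD(1-3)[OF assms(1)] assms(3,4)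
  have "(h \<cdot> (f \<otimes> Id C S)) \<cdot> (Id C B' \<otimes> act) \<cdot> asc B' S X
    = h \<cdot> (Id C B \<otimes> act) \<cdot> (f \<otimes> Id C (S \<odot> X)) \<cdot> asc B' S X"
    by (simp add: reassoc[OF whisker_exchange])
  also have "\<dots> = (h \<cdot> (Id C B \<otimes> act) \<cdot> asc B S X) \<cdot> ((f \<otimes> Id C S) \<otimes> Id C X)"
    by (simp add: asc_natural)
  also have "\<dots> = \<alpha> \<cdot> ((h \<cdot> (f \<otimes> Id C S)) \<otimes> Id C X)"
    unfolding equivariantD(4)[OF assms(1)] by simp
  finally show ?thesis by (simp add: equivariant_def in_hom_iff)
qed

lemma equivariant_comp_target:
  assumes "equivariant B A \<alpha> h" "f \<in> hom C A A'" "f \<cdot> \<alpha> = \<alpha>' \<cdot> (f \<otimes> Id C X)" "B \<in> Ob C"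
    "\<alpha> \<in> hom C (A \<odot> X) A" "\<alpha>' \<in> hom C (A' \<odot> X) A'"
  shows "equivariant B A' \<alpha>' (f \<cdot> h)"
proof -
  have [simp]: "f \<in> Arr C" "Dom C f = A" "Cod C f = A'" "\<alpha> \<in> Arr C" "Dom C \<alpha> = A \<odot> X" "Cod C \<alpha> = A"
    "\<alpha>' \<in> Arr C" "Dom C \<alpha>' = A' \<odot> X" "Cod C \<alpha>' = A'"
    using assms(2,5,6) by (auto simp: in_hom_iff)
  note [simp] = equivariantD(1-3)[OF assms(1)] assms(4)
  have "(f \<cdot> h) \<cdot> (Id C B \<otimes> act) \<cdot> asc B S X = \<alpha>' \<cdot> ((f \<cdot> h) \<otimes> Id C X)"
    by (simp add: equivariantD(4)[OF assms(1)] reassoc[OF assms(3)])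
  then show ?thesis by (simp add: equivariant_def in_hom_iff)
qed

text \<open>Here \<open>h \<cdot> (Id \<otimes> g)\<close> is equivariant for the iterated action on \<open>A \<odot> (B \<odot> S)\<close>, and the pentagon says that
the associator \<open>(A \<odot> B) \<odot> S \<rightarrow> A \<odot> (B \<odot> S)\<close> is equivariant.\<close>
lemma equivariant_tensor:
  assumes "equivariant A D \<alpha> h" "equivariant B S act g" "A \<in> Ob C" "B \<in> Ob C" "\<alpha> \<in> hom C (D \<odot> X) D"
  shows "equivariant (A \<odot> B) D \<alpha> (h \<cdot> (Id C A \<otimes> g) \<cdot> asc A B S)"
proof -
  have [simp]: "\<alpha> \<in> Arr C" "Dom C \<alpha> = D \<odot> X" "Cod C \<alpha> = D"
    using assms(5) by (auto simp: in_hom_iff)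
  note [simp] = equivariantD(1-3)[OF assms(1)] equivariantD(1-3)[OF assms(2)] assms(3,4)
  have "(h \<cdot> (Id C A \<otimes> g) \<cdot> asc A B S) \<cdot> (Id C (A \<odot> B) \<otimes> act) \<cdot> asc (A \<odot> B) S X
    = h \<cdot> (Id C A \<otimes> g) \<cdot> (Id C A \<otimes> (Id C B \<otimes> act)) \<cdot> asc A B (S \<odot> X) \<cdot> asc (A \<odot> B) S X"
    by (simp add: reassoc[OF asc_natural] flip: tensor_Id)
  also have "\<dots> = h \<cdot> (Id C A \<otimes> (g \<cdot> (Id C B \<otimes> act) \<cdot> asc B S X)) \<cdot> asc A (B \<odot> S) X \<cdot> (asc A B S \<otimes> Id C X)"
    by (simp flip: pentagon)
  also have "\<dots> = h \<cdot> (Id C A \<otimes> act) \<cdot> (Id C A \<otimes> (g \<otimes> Id C X)) \<cdot> asc A (B \<odot> S) X \<cdot> (asc A B S \<otimes> Id C X)"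
    unfolding equivariantD(4)[OF assms(2)] by simp
  also have "\<dots> = (h \<cdot> (Id C A \<otimes> act) \<cdot> asc A S X) \<cdot> ((Id C A \<otimes> g) \<otimes> Id C X) \<cdot> (asc A B S \<otimes> Id C X)"
    by (simp add: reassoc[OF asc_natural])
  also have "\<dots> = \<alpha> \<cdot> ((h \<cdot> (Id C A \<otimes> g) \<cdot> asc A B S) \<otimes> Id C X)"
    unfolding equivariantD(4)[OF assms(1)] by simp
  finally show ?thesis by (simp add: equivariant_def in_hom_iff)
qed

section \<open>The commutative monoid\<close>

text \<open>The multiplication of \<open>S\<close> lets \<open>S\<close> act on itself by extending the action of \<open>X\<close>; on
\<open>X\<^sup>m\<close> and \<open>X\<^sup>n\<close> it appends the \<open>n\<close> factors one at a time.\<close>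
definition mult where "mult = extension S act"

lemma mult_typing [simp]: "mult \<in> Arr C" "Dom C mult = S \<odot> S" "Cod C mult = S"
  unfolding mult_def using extension_typing[OF commuting_act] by simp_all

lemma mult_unit_right: "mult \<cdot> (Id C S \<otimes> \<iota> 0) = run S"
  unfolding mult_def by (rule extension_unit[OF commuting_act])

lemma mult_equivariant: "equivariant S S act mult"
  unfolding mult_def by (rule extension_equivariant[OF commuting_act])

text \<open>Both sides are equivariant maps out of \<open>(A \<odot> S) \<odot> S\<close> which agree on the unit of the last factor. For
\<open>\<alpha> = act\<close> this is associativity of \<open>mult\<close>.\<close>
lemma extension_mult:
  assumes "commuting_action A \<alpha>"
  shows "extension A \<alpha> \<cdot> (extension A \<alpha> \<otimes> Id C S) = extension A \<alpha> \<cdot> (Id C A \<otimes> mult) \<cdot> asc A S S"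
proof (rule equivariant_eqI)
  note [simp] = commuting_actionD(1-4)[OF assms] extension_typing[OF assms]
  have \<alpha>: "\<alpha> \<in> hom C (A \<odot> X) A" "extension A \<alpha> \<in> hom C (A \<odot> S) A"
    by (simp_all add: in_hom_iff)
  let ?h = "extension A \<alpha>"
  show "\<alpha> \<in> hom C (A \<odot> X) A" "A \<odot> S \<in> Ob C"
    by (simp_all add: in_hom_iff)
  show "equivariant (A \<odot> S) A \<alpha> (?h \<cdot> (?h \<otimes> Id C S))"
    by (rule equivariant_comp_source[OF extension_equivariant[OF assms]]) (simp_all add: \<alpha>)
  show "equivariant (A \<odot> S) A \<alpha> (?h \<cdot> (Id C A \<otimes> mult) \<cdot> asc A S S)"
    by (rule equivariant_tensor[OF extension_equivariant[OF assms] mult_equivariant]) (simp_all add: \<alpha>)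
  have "(?h \<cdot> (?h \<otimes> Id C S)) \<cdot> (Id C (A \<odot> S) \<otimes> \<iota> 0) = ?h \<cdot> (Id C A \<otimes> \<iota> 0) \<cdot> (?h \<otimes> Id C \<one>)"
    by (simp add: whisker_exchange)
  also have "\<dots> = ?h \<cdot> run (A \<odot> S)"
    by (simp add: reassoc[OF extension_unit[OF assms]] run_natural)
  also have "\<dots> = ?h \<cdot> (Id C A \<otimes> run S) \<cdot> asc A S \<one>"
    by (simp add: run_tensor)
  also have "\<dots> = ?h \<cdot> (Id C A \<otimes> mult) \<cdot> (Id C A \<otimes> (Id C S \<otimes> \<iota> 0)) \<cdot> asc A S \<one>"
    by (simp flip: mult_unit_right)
  also have "\<dots> = (?h \<cdot> (Id C A \<otimes> mult) \<cdot> asc A S S) \<cdot> (Id C (A \<odot> S) \<otimes> \<iota> 0)"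
    by (simp add: asc_natural flip: tensor_Id)
  finally show "(?h \<cdot> (?h \<otimes> Id C S)) \<cdot> (Id C (A \<odot> S) \<otimes> \<iota> 0) = \<dots>" .
qed

lemma lun_equivariant: "equivariant \<one> S act (lun S)"
proof -
  have "lun S \<cdot> (Id C \<one> \<otimes> act) \<cdot> asc \<one> S X = act \<cdot> (lun S \<otimes> Id C X)"
    by (simp add: reassoc[OF lun_natural] lun_tensor)
  then show ?thesis by (simp add: equivariant_def in_hom_iff)
qed

lemma mult_unit_left: "mult \<cdot> (\<iota> 0 \<otimes> Id C S) = lun S"
proof (rule equivariant_eqI[OF _ lun_equivariant])
  show "equivariant \<one> S act (mult \<cdot> (\<iota> 0 \<otimes> Id C S))"
    by (rule equivariant_comp_source[OF mult_equivariant]) (simp_all add: in_hom_iff)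
  show "(mult \<cdot> (\<iota> 0 \<otimes> Id C S)) \<cdot> (Id C \<one> \<otimes> \<iota> 0) = lun S \<cdot> (Id C \<one> \<otimes> \<iota> 0)"
    by (simp add: whisker_exchange reassoc[OF mult_unit_right] run_natural lun_natural lun_unit_eq_run_unit)
qed (simp_all add: in_hom_iff)

definition eta where "eta = act \<cdot> (\<iota> 0 \<otimes> Id C X) \<cdot> lun_inv X"

lemma eta_typing [simp]: "eta \<in> Arr C" "Dom C eta = X" "Cod C eta = S"
  by (simp_all add: eta_def)

text \<open>By definition \<open>eta\<close> lets \<open>X\<close> act on the unit of \<open>S\<close>. Equivariance turns this into the action of \<open>X\<close>
on \<open>A\<close> after that of the unit, which is trivial.\<close>
lemma equivariant_eta:
  assumes "equivariant A A \<alpha> h" "h \<cdot> (Id C A \<otimes> \<iota> 0) = run A" "A \<in> Ob C" "\<alpha> \<in> hom C (A \<odot> X) A"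
  shows "h \<cdot> (Id C A \<otimes> eta) = \<alpha>"
proof -
  have [simp]: "\<alpha> \<in> Arr C" "Dom C \<alpha> = A \<odot> X" "Cod C \<alpha> = A" "A \<in> Ob C"
    using assms(3,4) by (auto simp: in_hom_iff)
  note [simp] = equivariantD(1-3)[OF assms(1)]
  have "h \<cdot> (Id C A \<otimes> eta)
    = h \<cdot> (Id C A \<otimes> act) \<cdot> (Id C A \<otimes> (\<iota> 0 \<otimes> Id C X)) \<cdot> asc A \<one> X \<cdot> asc_inv A \<one> X \<cdot> (Id C A \<otimes> lun_inv X)"
    by (simp add: eta_def)
  also have "\<dots> = (h \<cdot> (Id C A \<otimes> act) \<cdot> asc A S X) \<cdot> ((Id C A \<otimes> \<iota> 0) \<otimes> Id C X) \<cdot> asc_inv A \<one> X \<cdot> (Id C A \<otimes> lun_inv X)"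
    by (simp add: reassoc[OF asc_natural])
  also have "\<dots> = \<alpha> \<cdot> ((h \<cdot> (Id C A \<otimes> \<iota> 0)) \<otimes> Id C X) \<cdot> asc_inv A \<one> X \<cdot> (Id C A \<otimes> lun_inv X)"
    unfolding equivariantD(4)[OF assms(1)] by simp
  also have "\<dots> = \<alpha> \<cdot> (Id C A \<otimes> lun X) \<cdot> asc A \<one> X \<cdot> asc_inv A \<one> X \<cdot> (Id C A \<otimes> lun_inv X)"
    unfolding assms(2) by (simp flip: triangle)
  also have "\<dots> = \<alpha>"
    by (simp add: interchange)
  finally show ?thesis .
qed

lemma extension_eta:
  assumes "commuting_action A \<alpha>"
  shows "extension A \<alpha> \<cdot> (Id C A \<otimes> eta) = \<alpha>"
  using equivariant_eta[OF extension_equivariant extension_unit, OF assms assms] assms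
  by (simp add: commuting_action_def)

text \<open>The commutation axiom says that \<open>\<alpha> : A \<odot> X \<rightarrow> A\<close> is itself a map of actions, where \<open>X\<close> acts on \<open>A\<close>
inside \<open>A \<odot> X\<close>. Hence acting by \<open>X\<close> first and by \<open>S\<close> afterwards is equivariant as well as acting in the
opposite order, and the two agree on the unit of \<open>S\<close>.\<close>
lemma extension_action_exchange:
  assumes "commuting_action A \<alpha>"
  shows "extension A \<alpha> \<cdot> (\<alpha> \<otimes> Id C S) = \<alpha> \<cdot> (extension A \<alpha> \<otimes> Id C X) \<cdot> exchange A X S"
proof (rule equivariant_eqI)
  note [simp] = commuting_actionD(1-4)[OF assms] extension_typing[OF assms]
  have \<alpha>: "\<alpha> \<in> hom C (A \<odot> X) A"
    by (simp_all add: in_hom_iff)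
  let ?h = "extension A \<alpha>" and ?e = "exchange A X S"
  show "\<alpha> \<in> hom C (A \<odot> X) A" "A \<odot> X \<in> Ob C"
    by (simp_all add: in_hom_iff)
  show "equivariant (A \<odot> X) A \<alpha> (?h \<cdot> (\<alpha> \<otimes> Id C S))"
    by (rule equivariant_comp_source[OF extension_equivariant[OF assms]]) (simp_all add: \<alpha>)
  have "(\<alpha> \<cdot> (?h \<otimes> Id C X) \<cdot> ?e) \<cdot> (Id C (A \<odot> X) \<otimes> act) \<cdot> asc (A \<odot> X) S X
    = \<alpha> \<cdot> (?h \<otimes> Id C X) \<cdot> ((Id C A \<otimes> act) \<otimes> Id C X) \<cdot> exchange A X (S \<odot> X) \<cdot> asc (A \<odot> X) S X"
    by (simp add: reassoc[OF exchange_natural] flip: tensor_Id)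
  also have "\<dots> = \<alpha> \<cdot> ((?h \<cdot> (Id C A \<otimes> act) \<cdot> asc A S X) \<otimes> Id C X) \<cdot> exchange (A \<odot> S) X X \<cdot> (?e \<otimes> Id C X)"
    by (simp add: exchange_tensor)
  also have "\<dots> = \<alpha> \<cdot> (\<alpha> \<otimes> Id C X) \<cdot> ((?h \<otimes> Id C X) \<otimes> Id C X) \<cdot> exchange (A \<odot> S) X X \<cdot> (?e \<otimes> Id C X)"
    unfolding equivariantD(4)[OF extension_equivariant[OF assms]] by simp
  also have "\<dots> = (\<alpha> \<cdot> (\<alpha> \<otimes> Id C X) \<cdot> exchange A X X) \<cdot> ((?h \<otimes> Id C X) \<otimes> Id C X) \<cdot> (?e \<otimes> Id C X)"
    by (simp add: reassoc[OF exchange_natural])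
  also have "\<dots> = \<alpha> \<cdot> ((\<alpha> \<cdot> (?h \<otimes> Id C X) \<cdot> ?e) \<otimes> Id C X)"
    unfolding commuting_actionD(5)[OF assms] by simp
  finally show "equivariant (A \<odot> X) A \<alpha> (\<alpha> \<cdot> (?h \<otimes> Id C X) \<cdot> ?e)"
    by (simp add: equivariant_def in_hom_iff)
  have "(?h \<cdot> (\<alpha> \<otimes> Id C S)) \<cdot> (Id C (A \<odot> X) \<otimes> \<iota> 0) = ?h \<cdot> (Id C A \<otimes> \<iota> 0) \<cdot> (\<alpha> \<otimes> Id C \<one>)"
    by (simp add: whisker_exchange)
  also have "\<dots> = \<alpha> \<cdot> run (A \<odot> X)"
    by (simp add: reassoc[OF extension_unit[OF assms]] run_natural)
  also have "\<dots> = \<alpha> \<cdot> ((?h \<cdot> (Id C A \<otimes> \<iota> 0)) \<otimes> Id C X) \<cdot> exchange A X \<one>"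
    unfolding extension_unit[OF assms] by (simp add: exchange_unit)
  also have "\<dots> = (\<alpha> \<cdot> (?h \<otimes> Id C X) \<cdot> ?e) \<cdot> (Id C (A \<odot> X) \<otimes> \<iota> 0)"
    by (simp add: exchange_natural flip: tensor_Id)
  finally show "(?h \<cdot> (\<alpha> \<otimes> Id C S)) \<cdot> (Id C (A \<odot> X) \<otimes> \<iota> 0) = \<dots>" .
qed

text \<open>Two equivariant maps that agree on the unit. Equivariance of \<open>mult \<cdot> sym\<close> is where commutativity
comes from: appending a factor to the left-hand argument is, by \<open>extension_action_exchange\<close>, the same
as appending it to the product.\<close>
lemma mult_sym: "mult \<cdot> sym S S = mult"
proof (rule equivariant_eqI[OF _ mult_equivariant])
  have "(mult \<cdot> sym S S) \<cdot> (Id C S \<otimes> act) \<cdot> asc S S X = (mult \<cdot> (act \<otimes> Id C S)) \<cdot> sym S (S \<odot> X) \<cdot> asc S S X"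
    by (simp add: reassoc[OF sym_natural])
  also have "\<dots> = act \<cdot> (mult \<otimes> Id C X) \<cdot> asc_inv S S X \<cdot> (Id C S \<otimes> sym X S) \<cdot>
      asc S X S \<cdot> sym S (S \<odot> X) \<cdot> asc S S X"
    unfolding mult_def extension_action_exchange[OF commuting_act]
    unfolding mult_def[symmetric] exchange_def by simp
  also have "\<dots> = act \<cdot> (mult \<otimes> Id C X) \<cdot> asc_inv S S X \<cdot> (Id C S \<otimes> (sym X S \<cdot> sym S X)) \<cdot>
      asc S S X \<cdot> (sym S S \<otimes> Id C X)"
    by (simp add: hexagon)
  also have "\<dots> = act \<cdot> ((mult \<cdot> sym S S) \<otimes> Id C X)"
    by (simp only: symmetry_involutive X_Ob inclusion_typing(1)) simp
  finally show "equivariant S S act (mult \<cdot> sym S S)"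
    by (simp add: equivariant_def in_hom_iff)
  show "(mult \<cdot> sym S S) \<cdot> (Id C S \<otimes> \<iota> 0) = mult \<cdot> (Id C S \<otimes> \<iota> 0)"
    by (simp add: sym_natural reassoc[OF mult_unit_left] lun_sym mult_unit_right)
qed (simp_all add: in_hom_iff)

lemma commutative_monoid_S: "commutative_monoid_object C S (\<iota> 0) mult"
  using extension_mult[OF commuting_act] mult_sym mult_unit_left mult_unit_right
  by (simp add: commutative_monoid_object_def in_hom_iff flip: mult_def)

section \<open>Restricting and extending actions\<close>

lemma commuting_restricted_action:
  assumes "commutative_monoid_object C M u m" "right_module M u m A \<rho>" "g \<in> hom C X M"
  shows "commuting_action A (\<rho> \<cdot> (Id C A \<otimes> g))"
proof -
  note M [simp] = commutative_monoidD(1-7)[OF assms(1)] right_moduleD(1-4)[OF assms(2)]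
  have [simp]: "g \<in> Arr C" "Dom C g = X" "Cod C g = M"
    using assms(3) by (auto simp: in_hom_iff)
  let ?\<alpha> = "\<rho> \<cdot> (Id C A \<otimes> g)"
  note twice = restricted_action_twice[OF assms X_Ob]
  have "?\<alpha> \<cdot> (?\<alpha> \<otimes> Id C X) \<cdot> exchange A X X = (?\<alpha> \<cdot> (?\<alpha> \<otimes> Id C X)) \<cdot> exchange A X X"
    by simp
  also have "\<dots> = \<rho> \<cdot> (Id C A \<otimes> (m \<cdot> (g \<otimes> g) \<cdot> sym X X)) \<cdot> asc A X X"
    unfolding twice by (simp add: asc_exchange)
  also have "(g \<otimes> g) \<cdot> sym X X = sym M M \<cdot> (g \<otimes> g)"
    by (simp add: sym_natural)
  also have "m \<cdot> sym M M \<cdot> (g \<otimes> g) = m \<cdot> (g \<otimes> g)"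
    by (simp add: reassoc[OF commutative_monoidD(11)[OF assms(1)]])
  finally have "?\<alpha> \<cdot> (?\<alpha> \<otimes> Id C X) \<cdot> exchange A X X = ?\<alpha> \<cdot> (?\<alpha> \<otimes> Id C X)"
    unfolding twice .
  then show ?thesis
    by (simp add: commuting_action_def in_hom_iff)
qed

lemma module_extension:
  "commuting_action A \<alpha> \<Longrightarrow> right_module S (\<iota> 0) mult A (extension A \<alpha>)"
  using extension_mult extension_unit extension_typing commuting_actionD(1)
  by (auto simp: right_module_def in_hom_iff)

lemma act_eq_mult_eta: "mult \<cdot> (Id C S \<otimes> eta) = act"
  unfolding mult_def by (rule extension_eta[OF commuting_act])

text \<open>Module associativity makes \<open>\<rho>\<close> equivariant for its own restriction, and equivariant maps are
determined by their values on the unit.\<close>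
lemma extension_restricted_action:
  assumes "right_module S (\<iota> 0) mult A \<rho>"
  shows "extension A (\<rho> \<cdot> (Id C A \<otimes> eta)) = \<rho>"
proof (rule equivariant_eqI)
  note [simp] = right_moduleD(1-4)[OF assms]
  let ?\<alpha> = "\<rho> \<cdot> (Id C A \<otimes> eta)"
  have comm: "commuting_action A ?\<alpha>"
    by (rule commuting_restricted_action[OF commutative_monoid_S assms]) (simp add: in_hom_iff)
  then show "equivariant A A ?\<alpha> (extension A ?\<alpha>)" "A \<in> Ob C" "?\<alpha> \<in> hom C (A \<odot> X) A"
    by (simp_all add: extension_equivariant commuting_action_def)
  have "\<rho> \<cdot> (Id C A \<otimes> act) \<cdot> asc A S X = (\<rho> \<cdot> (Id C A \<otimes> mult) \<cdot> asc A S S) \<cdot> (Id C (A \<odot> S) \<otimes> eta)"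
    by (simp add: asc_natural flip: tensor_Id act_eq_mult_eta)
  also have "\<dots> = ?\<alpha> \<cdot> (\<rho> \<otimes> Id C X)"
    unfolding right_moduleD(5)[OF assms, symmetric] by (simp add: whisker_exchange)
  finally show "equivariant A A ?\<alpha> \<rho>"
    by (simp add: equivariant_def in_hom_iff)
  show "extension A ?\<alpha> \<cdot> (Id C A \<otimes> \<iota> 0) = \<rho> \<cdot> (Id C A \<otimes> \<iota> 0)"
    by (simp only: extension_unit[OF comm] right_moduleD(6)[OF assms])
qed

lemma action_map_extension:
  assumes "commuting_action A \<alpha>" "commuting_action B \<beta>" "f \<in> hom C A B" "f \<cdot> \<alpha> = \<beta> \<cdot> (f \<otimes> Id C X)"
  shows "f \<cdot> extension A \<alpha> = extension B \<beta> \<cdot> (f \<otimes> Id C S)"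
proof (rule equivariant_eqI)
  note [simp] = commuting_actionD(1-4)[OF assms(1)] commuting_actionD(1-4)[OF assms(2)]
    extension_typing[OF assms(1)] extension_typing[OF assms(2)]
  have [simp]: "f \<in> Arr C" "Dom C f = A" "Cod C f = B"
    using assms(3) by (auto simp: in_hom_iff)
  show "A \<in> Ob C" "\<beta> \<in> hom C (B \<odot> X) B"
    by (simp_all add: in_hom_iff)
  show "equivariant A B \<beta> (f \<cdot> extension A \<alpha>)"
    by (rule equivariant_comp_target[OF extension_equivariant[OF assms(1)] assms(3,4)])
      (simp_all add: in_hom_iff)
  show "equivariant A B \<beta> (extension B \<beta> \<cdot> (f \<otimes> Id C S))"
    by (rule equivariant_comp_source[OF extension_equivariant[OF assms(2)] assms(3)])
      (simp_all add: in_hom_iff)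
  show "(f \<cdot> extension A \<alpha>) \<cdot> (Id C A \<otimes> \<iota> 0) = (extension B \<beta> \<cdot> (f \<otimes> Id C S)) \<cdot> (Id C A \<otimes> \<iota> 0)"
    by (simp add: extension_unit[OF assms(1)] whisker_exchange reassoc[OF extension_unit[OF assms(2)]] run_natural)
qed

section \<open>Freeness\<close>

text \<open>For a commutative monoid \<open>N\<close> with a map \<open>g\<close> from \<open>X\<close>, monoid maps \<open>S \<rightarrow> N\<close> extending \<open>g\<close> are
the same as maps of actions that preserve the unit. This direction holds since \<open>h \<cdot> mult\<close> and
\<open>n \<cdot> (h \<otimes> h)\<close> are equivariant and agree on the unit.\<close>
lemma monoid_hom_of_action_map:
  assumes N: "commutative_monoid_object C N v n" and g: "g \<in> hom C X N" and h: "h \<in> hom C S N"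
    and unit: "h \<cdot> \<iota> 0 = v" and act: "h \<cdot> act = (n \<cdot> (Id C N \<otimes> g)) \<cdot> (h \<otimes> Id C X)"
  shows "h \<in> monoid_hom C S (\<iota> 0) mult N v n" "h \<cdot> eta = g"
proof -
  note [simp] = commutative_monoidD(1-7)[OF N]
  have [simp]: "g \<in> Arr C" "Dom C g = X" "Cod C g = N" "h \<in> Arr C" "Dom C h = S" "Cod C h = N"
    using g h by (auto simp: in_hom_iff)
  let ?\<alpha> = "n \<cdot> (Id C N \<otimes> g)"
  have \<alpha>: "?\<alpha> \<in> hom C (N \<odot> X) N"
    by (simp add: in_hom_iff)
  have "h \<cdot> mult = (n \<cdot> (Id C N \<otimes> h)) \<cdot> (h \<otimes> Id C S)"
  proof (rule equivariant_eqI)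
    show "S \<in> Ob C" "?\<alpha> \<in> hom C (N \<odot> X) N"
      by (simp_all add: in_hom_iff)
    show "equivariant S N ?\<alpha> (h \<cdot> mult)"
      by (rule equivariant_comp_target[OF mult_equivariant h act]) (simp_all add: in_hom_iff)
    have "(n \<cdot> (Id C N \<otimes> h)) \<cdot> (Id C N \<otimes> act) \<cdot> asc N S X = n \<cdot> (Id C N \<otimes> (h \<cdot> act)) \<cdot> asc N S X"
      by simp
    also have "\<dots> = (n \<cdot> (Id C N \<otimes> n) \<cdot> asc N N N) \<cdot> (Id C (N \<odot> N) \<otimes> g) \<cdot> ((Id C N \<otimes> h) \<otimes> Id C X)"
      unfolding act by (simp add: asc_natural reassoc[OF asc_natural] flip: tensor_Id)
    also have "\<dots> = ?\<alpha> \<cdot> ((n \<cdot> (Id C N \<otimes> h)) \<otimes> Id C X)"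
      unfolding commutative_monoidD(8)[OF N, symmetric] by (simp add: reassoc[OF whisker_exchange])
    finally have "equivariant N N ?\<alpha> (n \<cdot> (Id C N \<otimes> h))"
      by (simp add: equivariant_def in_hom_iff)
    then show "equivariant S N ?\<alpha> ((n \<cdot> (Id C N \<otimes> h)) \<cdot> (h \<otimes> Id C S))"
      by (rule equivariant_comp_source) (simp_all add: in_hom_iff)
    have "((n \<cdot> (Id C N \<otimes> h)) \<cdot> (h \<otimes> Id C S)) \<cdot> (Id C S \<otimes> \<iota> 0) = n \<cdot> (Id C N \<otimes> (h \<cdot> \<iota> 0)) \<cdot> (h \<otimes> Id C \<one>)"
      by (simp add: whisker_exchange)
    also have "\<dots> = h \<cdot> run S"
      unfolding unit by (simp add: reassoc[OF commutative_monoidD(10)[OF N]] run_natural)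
    finally show "(h \<cdot> mult) \<cdot> (Id C S \<otimes> \<iota> 0) = ((n \<cdot> (Id C N \<otimes> h)) \<cdot> (h \<otimes> Id C S)) \<cdot> (Id C S \<otimes> \<iota> 0)"
      by (simp add: mult_unit_right)
  qed
  then show "h \<in> monoid_hom C S (\<iota> 0) mult N v n"
    by (simp add: monoid_hom_def interchange unit in_hom_iff)
  have "h \<cdot> eta = (h \<cdot> act) \<cdot> (\<iota> 0 \<otimes> Id C X) \<cdot> lun_inv X"
    by (simp add: eta_def)
  also have "\<dots> = ?\<alpha> \<cdot> ((h \<cdot> \<iota> 0) \<otimes> Id C X) \<cdot> lun_inv X"
    unfolding act by simp
  also have "\<dots> = n \<cdot> (v \<otimes> Id C N) \<cdot> (Id C \<one> \<otimes> g) \<cdot> lun_inv X"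
    unfolding unit by (simp add: reassoc[OF whisker_exchange])
  also have "\<dots> = g"
    by (simp add: reassoc[OF commutative_monoidD(9)[OF N]] reassoc[OF lun_natural])
  finally show "h \<cdot> eta = g" .
qed

lemma action_map_of_monoid_hom:
  assumes N: "commutative_monoid_object C N v n" and h: "h \<in> monoid_hom C S (\<iota> 0) mult N v n"
  shows "h \<cdot> act = (n \<cdot> (Id C N \<otimes> (h \<cdot> eta))) \<cdot> (h \<otimes> Id C X)"
proof -
  note [simp] = commutative_monoidD(1-7)[OF N]
  have [simp]: "h \<in> Arr C" "Dom C h = S" "Cod C h = N" and mult: "h \<cdot> mult = n \<cdot> (h \<otimes> h)"
    using h by (auto simp: in_hom_iff monoid_hom_def)
  have "(h \<otimes> h) \<cdot> (Id C S \<otimes> eta) = (Id C N \<otimes> (h \<cdot> eta)) \<cdot> (h \<otimes> Id C X)"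
    by (simp add: interchange del: whisker_comp)
  then show ?thesis
    unfolding act_eq_mult_eta[symmetric] by (simp add: reassoc[OF mult] del: whisker_comp)
qed

lemma action_map_unique:
  assumes "h \<in> hom C S N" "k \<in> hom C S N" "N \<in> Ob C" "\<alpha> \<in> hom C (N \<odot> X) N"
    and "h \<cdot> act = \<alpha> \<cdot> (h \<otimes> Id C X)" "k \<cdot> act = \<alpha> \<cdot> (k \<otimes> Id C X)" "h \<cdot> \<iota> 0 = k \<cdot> \<iota> 0"
  shows "h = k"
proof (rule inclusions_jointly_epic[OF assms(1,2)])
  have step: "f \<cdot> \<iota> (Suc n) = \<alpha> \<cdot> ((f \<cdot> \<iota> n) \<otimes> Id C X)"
    if "f \<in> hom C S N" "f \<cdot> act = \<alpha> \<cdot> (f \<otimes> Id C X)" for f n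
    using that assms(3,4) by (simp add: reassoc[OF that(2)] in_hom_iff flip: act_inclusion)
  show "h \<cdot> \<iota> n = k \<cdot> \<iota> n" for n
  proof (induction n)
    case (Suc n)
    then show ?case
      by (simp only: step[OF assms(1,5)] step[OF assms(2,6)])
  qed (rule assms(7))
qed

text \<open>Let \<open>S\<close> act on the element \<open>v\<close> of \<open>N\<close>.\<close>
lemma action_map_exists:
  assumes "commuting_action N \<alpha>" "v \<in> hom C \<one> N"
  shows "\<exists>h. h \<in> hom C S N \<and> h \<cdot> \<iota> 0 = v \<and> h \<cdot> act = \<alpha> \<cdot> (h \<otimes> Id C X)"
proof (intro exI conjI)
  note [simp] = commuting_actionD(1-4)[OF assms(1)] extension_typing[OF assms(1)]
  have [simp]: "v \<in> Arr C" "Dom C v = \<one>" "Cod C v = N"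
    using assms(2) by (auto simp: in_hom_iff)
  let ?k = "extension N \<alpha> \<cdot> (v \<otimes> Id C S)"
  let ?h = "?k \<cdot> lun_inv S"
  show "?h \<in> hom C S N"
    by (simp add: in_hom_iff)
  have "?h \<cdot> \<iota> 0 = extension N \<alpha> \<cdot> (Id C N \<otimes> \<iota> 0) \<cdot> (v \<otimes> Id C \<one>) \<cdot> lun_inv \<one>"
    by (simp add: lun_inv_natural reassoc[OF whisker_exchange])
  also have "\<dots> = v \<cdot> lun \<one> \<cdot> lun_inv \<one>"
    by (simp add: reassoc[OF extension_unit[OF assms(1)]] reassoc[OF run_natural] flip: lun_unit_eq_run_unit)
  finally show "?h \<cdot> \<iota> 0 = v"
    by simp
  have k: "equivariant \<one> N \<alpha> ?k"
    by (rule equivariant_comp_source[OF extension_equivariant[OF assms(1)] assms(2)])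
      (simp_all add: in_hom_iff)
  have "?h \<cdot> act = (?k \<cdot> (Id C \<one> \<otimes> act) \<cdot> asc \<one> S X) \<cdot> (lun_inv S \<otimes> Id C X)"
    by (simp add: lun_inv_natural lun_inv_tensor)
  also have "\<dots> = \<alpha> \<cdot> (?h \<otimes> Id C X)"
    unfolding equivariantD(4)[OF k] by simp
  finally show "?h \<cdot> act = \<alpha> \<cdot> (?h \<otimes> Id C X)" .
qed

lemma free_commutative_monoid_S: "free_commutative_monoid C X S (\<iota> 0) mult eta"
  unfolding free_commutative_monoid_def
proof (intro conjI allI impI)
  fix N v n g
  assume *: "commutative_monoid_object C N v n \<and> g \<in> hom C X N"
  then have N: "commutative_monoid_object C N v n" and g: "g \<in> hom C X N" by auto
  let ?\<alpha> = "n \<cdot> (Id C N \<otimes> g)"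
  have comm: "commuting_action N ?\<alpha>"
    by (rule commuting_restricted_action[OF N right_module_self[OF N] g])
  have v: "v \<in> hom C \<one> N" and N_Ob: "N \<in> Ob C"
    using N by (auto simp: commutative_monoid_object_def)
  show "\<exists>!h. h \<in> monoid_hom C S (\<iota> 0) mult N v n \<and> h \<cdot> eta = g"
  proof (rule ex_ex1I)
    obtain h where "h \<in> hom C S N" "h \<cdot> \<iota> 0 = v" "h \<cdot> act = ?\<alpha> \<cdot> (h \<otimes> Id C X)"
      using action_map_exists[OF comm v] by blast
    then show "\<exists>h. h \<in> monoid_hom C S (\<iota> 0) mult N v n \<and> h \<cdot> eta = g"
      using monoid_hom_of_action_map[OF N g] by blast
    fix h k
    assume h: "h \<in> monoid_hom C S (\<iota> 0) mult N v n \<and> h \<cdot> eta = g"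
      and k: "k \<in> monoid_hom C S (\<iota> 0) mult N v n \<and> k \<cdot> eta = g"
    then show "h = k"
      using action_map_of_monoid_hom[OF N, of h] action_map_of_monoid_hom[OF N, of k] comm
      by (intro action_map_unique[of h N k ?\<alpha>, OF _ _ N_Ob])
        (simp_all add: monoid_hom_def commuting_action_def)
  qed
qed (simp_all add: commutative_monoid_S in_hom_iff)

section \<open>The isomorphism between modules and commuting actions\<close>

lemma module_category_eq:
  "module_category C S (\<iota> 0) mult = action_category C S {(A, \<rho>). right_module S (\<iota> 0) mult A \<rho>}"
  by (simp add: module_category_def right_module_def)

lemma commuting_action_category_eq:
  "commuting_action_category C X = action_category C X {(A, \<alpha>). commuting_action A \<alpha>}"
proof -
  have "commuting_action A \<alpha> \<longleftrightarrow> A \<in> Ob C \<and> \<alpha> \<in> hom C (A \<odot> X) A \<and>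
       \<alpha> \<cdot> (\<alpha> \<otimes> Id C X) \<cdot> asc_inv A X X \<cdot> (Id C A \<otimes> sym X X) \<cdot> asc A X X = \<alpha> \<cdot> (\<alpha> \<otimes> Id C X)" for A \<alpha>
    by (simp add: commuting_action_def exchange_def)
  then show ?thesis
    by (simp add: commuting_action_category_def)
qed

lemma restriction_isomorphism:
  "category_isomorphism (module_category C S (\<iota> 0) mult) (commuting_action_category C X)
    (restriction_functor C eta)"
proof -
  let ?M = "action_category C S {(A, \<rho>). right_module S (\<iota> 0) mult A \<rho>}"
  let ?A = "action_category C X {(A, \<alpha>). commuting_action A \<alpha>}"
  let ?F = "restriction_functor C eta"
  let ?e = "\<lambda>(A, \<alpha>). (A, extension A \<alpha>)"
  let ?G = "\<lparr>ob_map = ?e, arr_map = (\<lambda>(a, f, b). (?e a, f, ?e b))\<rparr>"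
  have eta: "eta \<in> hom C X S" by (simp add: in_hom_iff)
  have M: "category ?M"
    by (rule category_action_category) (simp_all add: right_module_def)
  have A: "category ?A"
    by (rule category_action_category) (simp_all add: commuting_action_def)
  have Ob: "Ob (action_category C Y P) = P" for Y P
    by (simp add: action_category_def)
  have ops: "Id (action_category C Y P) a = (a, Id C (fst a), a)"
    "(a', g, c) \<cdot>\<^bsub>action_category C Y P\<^esub> (a, f, b') = (a, g \<cdot> f, c)" for Y P a a' b' c f g
    by (simp_all add: action_category_def split: prod.split)
  note defs = restriction_functor_def restrict_action_def
  note restrict = commuting_restricted_action[OF commutative_monoid_S _ eta]
  have F: "is_functor ?M ?A ?F"
    using module_map_restrict[OF _ _ eta X_Ob inclusion_typing(1)]
    by (intro is_functor.intro is_functor_axioms.intro M A)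
      (auto simp: Ob ops action_category_hom_iff defs restrict)
  have G: "is_functor ?A ?M ?G"
    using action_map_extension
    by (intro is_functor.intro is_functor_axioms.intro M A)
      (auto simp: Ob ops action_category_hom_iff module_extension)
  show ?thesis
    unfolding module_category_eq commuting_action_category_eq category_isomorphism_def
    using F G
    by (intro conjI exI[of _ ?G]) (auto simp: action_category_def defs extension_eta extension_restricted_action)
qed

end

theorem proposition33:
  fixes C :: "('o, 'a) sym_mon_data"
  assumes "symmetric_monoidal_category C"
    and "admits_symmetric_algebra_construction C"
  shows "admits_algebraically_free_commutative_monoids C"
  unfolding admits_algebraically_free_commutative_monoids_def
proof
  fix X assume X: "X \<in> Ob C"
  then obtain S \<iota> where
    "is_colimit perm_category C (power_functor C X) S \<iota>"
    "\<And>A. A \<in> Ob C \<Longrightarrow> preserves_colimit perm_category C (tensor_left C A) (power_functor C X) S \<iota>"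
    "\<And>A. A \<in> Ob C \<Longrightarrow> preserves_colimit perm_category C (tensor_right C A) (power_functor C X) S \<iota>"
    using assms(2) unfolding admits_symmetric_algebra_construction_def by metis
  with X interpret symmetric_algebra C X S \<iota>
    by (intro symmetric_algebra.intro assms(1) symmetric_algebra_axioms.intro)
  show "\<exists>S u m \<eta>. free_commutative_monoid C X S u m \<eta> \<and>
    category_isomorphism (module_category C S u m) (commuting_action_category C X) (restriction_functor C \<eta>)"
    using free_commutative_monoid_S restriction_isomorphism by blast
qed

end
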